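(* Let $\tilde\gamma$ be the rescaled curve shortening flow in $\mathbb{R}^3$, i.e. a family of closed curves $\tilde\gamma(\tau,\cdot):S^1\to\mathbb{R}^3$ satisfying $$\partial_\tau\tilde{\gamma}=\frac{1}{2}\tilde\gamma+\frac{\tilde\gamma'\times(\tilde\gamma''\times\tilde\gamma')}{|\tilde\gamma'|^4},$$ and let $\psi=\arcsin\frac{\langle\tilde\gamma,\tilde\gamma'\rangle}{|\tilde\gamma||\tilde\gamma'|}\in[-\frac{\pi}{2},\frac{\pi}{2}]$. Then $$\frac{d}{d\tau}\int_{S^1}\frac{|\tilde\gamma'|}{|\tilde\gamma|}\cos\psi\,dx=-\int_{S^1}\frac{|\tilde\gamma'|}{|\tilde\gamma|^3\cos^3\psi}\,\kappa^2\,\big|\mathrm{Proj}_{\nu\times\tilde\gamma'}\tilde\gamma\big|^2\,dx-2\sum_{\psi(x)=\pm\frac{\pi}{2}}\frac{\kappa(x)}{|\tilde\gamma(x)|},$$ where the sum is taken over the points $x\in S^1$ at which $\psi=\pm\frac{\pi}{2}$ (equivalently $\tilde\gamma\parallel\tilde\gamma'$). Further, for an arbitrary continuous function $a\in C([0,\infty))$, $$\int_{S^1}a(|\tilde\gamma|)\,|\tilde\gamma'|\sin\psi\,dx=0.$$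
   Context: Let $\gamma:(0,T)\times S^1\to\mathbb{R}^3$ be a (smooth, regular) parametrized closed curve moving by curvature, $\partial_t\gamma=\kappa\nu$, whose first singularity appears at the point $0$ after finite time $T$. The rescaled flow is $\tau=-\log(T-t)$, $\tilde\gamma(\tau,x)=(T-t)^{-1/2}\gamma(t,x)$; it satisfies the equation displayed in the claim. The prime $'$ denotes the derivative in $x\in S^1$. For a curve, $\kappa=\frac{|\gamma''\times\gamma'|}{|\gamma'|^3}\ge 0$ is the curvature and $\nu=\frac{\gamma'\times(\gamma''\times\gamma')}{|\gamma'||\gamma''\times\gamma'|}$ is the unit normal vector; in the claim $\kappa,\nu$ are those of $\tilde\gamma(\tau,\cdot)$. Where $\kappa=0$, terms with the factor $\kappa^2$ are understood to be $0$. $\mathrm{Proj}_w v$ denotes the orthogonal projection of $v$ onto the line spanned by $w$. The angle $\psi$ is the signed angle between $\tilde\gamma$ and the plane orthogonal to $\tilde\gamma'$; it is understood that $\tilde\gamma\neq0$ so that the expressions are defined. *)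

theory Defs
  imports "HOL-Analysis.Analysis"
begin

unbundle no cross3_syntax

text \<open>\<open>C\<^sup>\<infinity>\<close> regularity on an open set, by iterated directional derivatives.\<close>

primrec higher_differentiable_on ::
  "'a::real_normed_vector set \<Rightarrow> ('a \<Rightarrow> 'b::real_normed_vector) \<Rightarrow> nat \<Rightarrow> bool" where
  "higher_differentiable_on S f 0 \<longleftrightarrow> continuous_on S f"
| "higher_differentiable_on S f (Suc n) \<longleftrightarrow>
     (\<forall>z\<in>S. f differentiable (at z)) \<and>
     (\<forall>v. higher_differentiable_on S (\<lambda>z. frechet_derivative f (at z) v) n)"

definition smooth_on ::
  "'a::real_normed_vector set \<Rightarrow> ('a \<Rightarrow> 'b::real_normed_vector) \<Rightarrow> bool" where
  "smooth_on S f \<longleftrightarrow> (\<forall>n. higher_differentiable_on S f n)"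

text \<open>The circle is \<open>\<real> / 2\<pi>\<int>\<close>: a closed curve is a \<open>2\<pi>\<close>-periodic map on the reals,
  integrals over it are integrals over \<open>{0..2\<pi>}\<close>, and \<open>{0..<2\<pi>}\<close> contains each of its points
  exactly once. In the following, \<open>c\<close> is a single closed curve.\<close>

definition tangent :: "(real \<Rightarrow> real^3) \<Rightarrow> real \<Rightarrow> real^3" where
  "tangent c x = vector_derivative c (at x)"

definition accel :: "(real \<Rightarrow> real^3) \<Rightarrow> real \<Rightarrow> real^3" where
  "accel c x = vector_derivative (tangent c) (at x)"

definition curvature :: "(real \<Rightarrow> real^3) \<Rightarrow> real \<Rightarrow> real" where
  "curvature c x = norm (cross3 (accel c x) (tangent c x)) / norm (tangent c x) ^ 3"

text \<open>Where the curvature vanishes, this takes the value \<open>0\<close>.\<close>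

definition unit_normal :: "(real \<Rightarrow> real^3) \<Rightarrow> real \<Rightarrow> real^3" where
  "unit_normal c x =
     (1 / (norm (tangent c x) * norm (cross3 (accel c x) (tangent c x)))) *\<^sub>R
       cross3 (tangent c x) (cross3 (accel c x) (tangent c x))"

definition psi :: "(real \<Rightarrow> real^3) \<Rightarrow> real \<Rightarrow> real" where
  "psi c x = arcsin ((c x \<bullet> tangent c x) / (norm (c x) * norm (tangent c x)))"

definition proj_line :: "'a::real_inner \<Rightarrow> 'a \<Rightarrow> 'a" where
  "proj_line w v = ((v \<bullet> w) / (w \<bullet> w)) *\<^sub>R w"

definition closed_regular_curve :: "(real \<Rightarrow> real^3) \<Rightarrow> bool" where
  "closed_regular_curve c \<longleftrightarrow> (\<forall>x. c (x + 2 * pi) = c x) \<and> (\<forall>x. tangent c x \<noteq> 0)"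

text \<open>Smoothness is joint in time and the curve parameter.\<close>

definition rescaled_csf :: "real set \<Rightarrow> (real \<Rightarrow> real \<Rightarrow> real^3) \<Rightarrow> bool" where
  "rescaled_csf J \<gamma> \<longleftrightarrow>
     open J \<and> is_interval J \<and>
     smooth_on (Sigma J (\<lambda>_. UNIV)) (\<lambda>(\<tau>, x). \<gamma> \<tau> x) \<and>
     (\<forall>\<tau>\<in>J. closed_regular_curve (\<gamma> \<tau>)) \<and>
     (\<forall>\<tau>\<in>J. \<forall>x. ((\<lambda>s. \<gamma> s x) has_vector_derivative
        ((1 / 2) *\<^sub>R \<gamma> \<tau> x +
         (1 / norm (tangent (\<gamma> \<tau>) x) ^ 4) *\<^sub>R
           cross3 (tangent (\<gamma> \<tau>) x) (cross3 (accel (\<gamma> \<tau>) x) (tangent (\<gamma> \<tau>) x)))) (at \<tau>))"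

definition radial_points :: "(real \<Rightarrow> real^3) \<Rightarrow> real set" where
  "radial_points c = {x \<in> {0..<2 * pi}. psi c x = pi / 2 \<or> psi c x = - pi / 2}"

text \<open>At points with \<open>cos \<psi> = 0\<close> this takes the value \<open>0\<close>.\<close>

definition curvature_density :: "(real \<Rightarrow> real^3) \<Rightarrow> real \<Rightarrow> real" where
  "curvature_density c x =
     norm (tangent c x) / (norm (c x) ^ 3 * cos (psi c x) ^ 3) * curvature c x ^ 2 *
     norm (proj_line (cross3 (unit_normal c x) (tangent c x)) (c x)) ^ 2"

end

theory Submission
  imports Defs
begin

text \<open>
  The quantity \<open>|\<gamma>'| / |\<gamma>| cos \<psi> = |\<gamma> \<times> \<gamma>'| / |\<gamma>|\<^sup>2\<close> is the speed of the radial projection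
  \<open>u = \<gamma> / |\<gamma>|\<close> of the curve to the unit sphere, so its integral \<open>L\<close> is the length of \<open>u\<close>, and the radial
  points are the points where \<open>u\<close> is stationary. Put \<open>A = u \<times> u'\<close>, so that \<open>|A|\<close> is the speed. Scaling
  does not change \<open>u\<close>, so only the curvature vector \<open>N = \<kappa>\<nu>\<close> moves it, and off the radial points the first
  variation of length reads
  \<open>\<partial>|A| / \<partial>\<tau> = F' - D\<close>, where \<open>F = \<langle>u' / |u'|, N\<rangle> / |\<gamma>|\<close> is a boundary flux and \<open>D \<ge> 0\<close> is
  the density in the claim (\<open>flux_deriv\<close>, \<open>curvature_density_eq\<close>).

  At a radial point with \<open>\<kappa> \<noteq> 0\<close> the unit tangent of \<open>u\<close> flips its direction: \<open>u\<close> has a cusp there, and \<open>F\<close>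
  jumps from \<open>- \<kappa> / |\<gamma>|\<close> to \<open>\<kappa> / |\<gamma>|\<close>; at the other radial points \<open>F\<close> tends to \<open>0\<close>
  (\<open>flux_tendsto\<close>). Hence the integral of \<open>F'\<close> over a gap between
  consecutive radial points is minus the sum of \<open>\<kappa> / |\<gamma>|\<close> at its two ends. Every radial point with
  \<open>\<kappa> \<noteq> 0\<close> is isolated, hence an end of exactly two gaps; this is the factor \<open>2\<close> of the sum.

  A priori the set \<open>Z\<close> of radial points is an arbitrary closed set, so two points need care.

  First, there may be infinitely many gaps. Their contributions are added by countable additivity. As the flux
  leaves every gap at both ends, \<open>D\<close> and the sum are controlled by the bounded function
  \<open>\<partial>|A| / \<partial>\<tau>\<close>, which gives the integrability of \<open>D\<close> and the summability of
  \<open>\<kappa> / |\<gamma>|\<close> along with the identity (\<open>flux_balance\<close>, \<open>periodic_flux_balance\<close>).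

  Second, \<open>|A|\<close> is not differentiable in time where \<open>A = 0\<close> and \<open>\<partial>A / \<partial>\<tau> \<noteq> 0\<close>. This happens
  at countably many points only: simple zeros of a curve are isolated, so that outside a countable set each point
  of \<open>Z\<close> has \<open>A' = 0\<close>, hence \<open>N = 0\<close>, and then also \<open>N' = 0\<close>; these equations imply
  \<open>\<partial>A / \<partial>\<tau> = 0\<close> (\<open>countable_angular_zeros_rate_nonzero\<close>). So dominated convergence differentiates the
  length \<open>L\<close> (\<open>has_real_derivative_integral_norm\<close>).

  The second claim holds because \<open>|\<gamma>'| sin \<psi>\<close> is the derivative of \<open>|\<gamma>|\<close>, so that the integrand is
  the derivative of a primitive of \<open>a\<close> evaluated at the periodic function \<open>|\<gamma>|\<close> (\<open>radial_integral_zero\<close>).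
\<close>

section \<open>Simple zeros of curves\<close>

lemma vector_derivative_tendsto_quotient:
  fixes V :: "real \<Rightarrow> 'a::real_normed_vector"
  assumes V: "(V has_vector_derivative V') (at z)"
  shows "((\<lambda>x. (V x - V z) /\<^sub>R (x - z)) \<longlongrightarrow> V') (at z)"
proof -
  have "((\<lambda>x. norm (V x - V z - (x - z) *\<^sub>R V') / norm (x - z)) \<longlongrightarrow> 0) (at z)"
    using V unfolding has_vector_derivative_def has_derivative_iff_norm by (rule conjunct2)
  then have "((\<lambda>x. norm ((V x - V z) /\<^sub>R (x - z) - V')) \<longlongrightarrow> 0) (at z)"
  proof (rule Lim_transform_eventually)
    have "norm (V x - V z - (x - z) *\<^sub>R V') / norm (x - z) = norm ((V x - V z) /\<^sub>R (x - z) - V')"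
      if "x \<noteq> z" for x
    proof -
      define h where "h = x - z"
      have "V' = (h *\<^sub>R V') /\<^sub>R h"
        using that by (simp add: h_def)
      then have "(V x - V z) /\<^sub>R h - V' = (V x - V z - h *\<^sub>R V') /\<^sub>R h"
        by (metis scaleR_diff_right)
      then have "norm ((V x - V z) /\<^sub>R h - V') = norm (V x - V z - h *\<^sub>R V') / norm h"
        by (simp only: norm_scaleR abs_inverse real_norm_def divide_inverse mult.commute)
      then show ?thesis
        unfolding h_def by (rule sym)
    qed
    then show "\<forall>\<^sub>F x in at z. norm (V x - V z - (x - z) *\<^sub>R V') / norm (x - z) =
        norm ((V x - V z) /\<^sub>R (x - z) - V')"
      unfolding eventually_at_filter by (intro always_eventually) blast
  qed
  then show ?thesis
    by (rule LIM_zero_cancel[OF tendsto_norm_zero_cancel])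
qed

text \<open>Second countability: each point has a basic neighbourhood that meets the set in this point only, and
  different points need different ones.\<close>

lemma countable_isolated:
  fixes S :: "'a::second_countable_topology set"
  assumes "\<And>x. x \<in> S \<Longrightarrow> \<not> x islimpt S"
  shows "countable S"
proof -
  obtain B :: "'a set set" where B: "countable B" "topological_basis B"
    using ex_countable_basis by blast
  have "\<exists>U\<in>B. U \<inter> S = {x}" if x: "x \<in> S" for x
  proof -
    obtain T where T: "open T" "x \<in> T" "\<And>y. y \<in> S \<Longrightarrow> y \<in> T \<Longrightarrow> y = x"
      using assms[OF x] unfolding islimpt_def by blast
    obtain U where "U \<in> B" "x \<in> U" "U \<subseteq> T"
      using topological_basisE[OF B(2) T(1,2)] by blast
    then show ?thesis
      using T x by blast
  qed
  then obtain U where U: "\<And>x. x \<in> S \<Longrightarrow> U x \<in> B \<and> U x \<inter> S = {x}"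
    by metis
  have "inj_on U S"
    using U by (metis inj_onI singleton_inject)
  moreover have "U ` S \<subseteq> B"
    using U by blast
  ultimately show ?thesis
    by (rule countable_image_inj_on[OF countable_subset[OF _ B(1)], rotated])
qed

text \<open>To first order the curve is \<open>(x - z) V'\<close> near the zero, so its direction reverses there.\<close>

lemma sgn_tendsto_at_simple_zero:
  fixes V :: "real \<Rightarrow> 'a::real_normed_vector"
  assumes V: "(V has_vector_derivative V') (at z)" and "V z = 0" and "V' \<noteq> 0"
  shows "((\<lambda>x. sgn (V x)) \<longlongrightarrow> sgn V') (at_right z)"
    and "((\<lambda>x. sgn (V x)) \<longlongrightarrow> - sgn V') (at_left z)"
proof -
  have "((\<lambda>x. V x /\<^sub>R (x - z)) \<longlongrightarrow> V') (at z)"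
    using vector_derivative_tendsto_quotient[OF V] \<open>V z = 0\<close> by simp
  then have lim: "((\<lambda>x. sgn (V x /\<^sub>R (x - z))) \<longlongrightarrow> sgn V') (at z)"
    using \<open>V' \<noteq> 0\<close> by (intro tendsto_sgn)
  have "((\<lambda>x. sgn (V x /\<^sub>R (x - z))) \<longlongrightarrow> sgn V') (at_right z)"
    using lim by (rule filterlim_mono) (auto simp: at_le)
  then show "((\<lambda>x. sgn (V x)) \<longlongrightarrow> sgn V') (at_right z)"
    by (rule Lim_transform_eventually, intro eventually_at_rightI[of z "z + 1"])
      (simp_all add: sgn_scaleR)
  have "((\<lambda>x. - sgn (V x /\<^sub>R (x - z))) \<longlongrightarrow> - sgn V') (at_left z)"
    by (rule tendsto_minus, rule filterlim_mono[OF lim]) (auto simp: at_le)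
  then show "((\<lambda>x. sgn (V x)) \<longlongrightarrow> - sgn V') (at_left z)"
    by (rule Lim_transform_eventually, intro eventually_at_leftI[of "z - 1" z])
      (simp_all add: sgn_scaleR)
qed

text \<open>Along zeros that accumulate at \<open>z\<close> the difference quotients vanish.\<close>

lemma simple_zero_isolated:
  fixes V :: "real \<Rightarrow> 'a::real_normed_vector"
  assumes V: "(V has_vector_derivative V') (at z)" and "V z = 0" and "V' \<noteq> 0"
  shows "\<not> z islimpt {x. V x = 0}"
proof
  assume "z islimpt {x. V x = 0}"
  then obtain s where s: "\<And>n. s n \<in> {x. V x = 0} - {z}" "s \<longlonglongrightarrow> z"
    unfolding islimpt_sequential by blast
  have "((\<lambda>x. V x /\<^sub>R (x - z)) \<longlongrightarrow> V') (at z)"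
    using vector_derivative_tendsto_quotient[OF V] \<open>V z = 0\<close> by simp
  then have "(\<lambda>n. V (s n) /\<^sub>R (s n - z)) \<longlonglongrightarrow> V'"
    by (rule filterlim_compose) (use s in \<open>simp add: filterlim_at\<close>)
  then have "(\<lambda>n::nat. 0) \<longlonglongrightarrow> V'"
    using s by simp
  then show False
    using \<open>V' \<noteq> 0\<close> LIMSEQ_unique tendsto_const by blast
qed

lemma countable_simple_zeros:
  fixes V :: "real \<Rightarrow> 'a::real_normed_vector"
  assumes V: "\<And>x. (V has_vector_derivative V' x) (at x)"
  shows "countable {x. V x = 0 \<and> V' x \<noteq> 0}"
proof (rule countable_isolated)
  fix z assume z: "z \<in> {x. V x = 0 \<and> V' x \<noteq> 0}"
  then have "\<not> z islimpt {x. V x = 0}"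
    using simple_zero_isolated[OF V] by blast
  then show "\<not> z islimpt {x. V x = 0 \<and> V' x \<noteq> 0}"
    using islimpt_subset[of z "{x. V x = 0 \<and> V' x \<noteq> 0}" "{x. V x = 0}"] by blast
qed

section \<open>Derivative of the integral of a norm\<close>

lemma bounded_bilinear_cross3: "bounded_bilinear cross3"
  using bilinear_cross by (simp add: bilinear_conv_bounded_bilinear)

lemmas continuous_on_cross3 = bounded_bilinear.continuous_on[OF bounded_bilinear_cross3]

lemma has_vector_derivative_cross3:
  assumes "(f has_vector_derivative f') (at x within S)" "(g has_vector_derivative g') (at x within S)"
  shows "((\<lambda>x. cross3 (f x) (g x)) has_vector_derivative cross3 (f x) g' + cross3 f' (g x)) (at x within S)"
  using bounded_bilinear.has_vector_derivative[OF bounded_bilinear_cross3 assms] .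

lemma has_real_derivative_inner:
  fixes f g :: "real \<Rightarrow> 'a::real_inner"
  assumes "(f has_vector_derivative f') (at x within S)" "(g has_vector_derivative g') (at x within S)"
  shows "((\<lambda>x. f x \<bullet> g x) has_real_derivative f x \<bullet> g' + f' \<bullet> g x) (at x within S)"
  using bounded_bilinear.has_vector_derivative[OF bounded_bilinear_inner assms]
  by (simp add: has_real_derivative_iff_has_vector_derivative)

lemma has_real_derivative_norm:
  fixes f :: "real \<Rightarrow> 'a::real_inner"
  assumes "(f has_vector_derivative f') (at x)" and "f x \<noteq> 0"
  shows "((\<lambda>x. norm (f x)) has_real_derivative (f x \<bullet> f') / norm (f x)) (at x)"
proof -
  have "0 < f x \<bullet> f x"
    using assms(2) by simp
  then have "((\<lambda>x. sqrt (f x \<bullet> f x)) has_real_derivative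
      inverse (sqrt (f x \<bullet> f x)) / 2 * (f x \<bullet> f' + f' \<bullet> f x)) (at x)"
    by (intro DERIV_chain2[OF DERIV_real_sqrt] has_real_derivative_inner assms(1))
  then show ?thesis
    by (simp add: norm_eq_sqrt_inner inner_commute field_simps)
qed

text \<open>The norm of \<open>W s x\<close> is Lipschitz in \<open>s\<close>, uniformly in \<open>x\<close>, and it is differentiable at \<open>\<tau>\<close> unless
  \<open>W \<tau> x\<close> is a simple zero in time. If this happens on a null set only, then dominated convergence applies to
  the difference quotients. At the other zeros of \<open>W \<tau>\<close> the derivative of the norm is \<open>0\<close>, the
  value of the fraction in the conclusion there.\<close>

lemma has_real_derivative_integral_norm:
  fixes W W' :: "real \<Rightarrow> real \<Rightarrow> 'a::euclidean_space"
  assumes \<epsilon>: "0 < \<epsilon>"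
    and W: "\<And>s x. \<bar>s - \<tau>\<bar> \<le> \<epsilon> \<Longrightarrow> x \<in> {a..b} \<Longrightarrow> ((\<lambda>s. W s x) has_vector_derivative W' s x) (at s)"
    and contW: "\<And>s. \<bar>s - \<tau>\<bar> \<le> \<epsilon> \<Longrightarrow> continuous_on {a..b} (W s)"
    and contW': "continuous_on ({\<tau> - \<epsilon>..\<tau> + \<epsilon>} \<times> {a..b}) (\<lambda>(s, x). W' s x)"
    and null: "negligible {x \<in> {a..b}. W \<tau> x = 0 \<and> W' \<tau> x \<noteq> 0}"
  shows "((\<lambda>s. integral {a..b} (\<lambda>x. norm (W s x))) has_real_derivative
    integral {a..b} (\<lambda>x. (W \<tau> x \<bullet> W' \<tau> x) / norm (W \<tau> x))) (at \<tau>)"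
proof -
  let ?K = "{\<tau> - \<epsilon>..\<tau> + \<epsilon>} \<times> {a..b}"
  let ?E = "{x \<in> {a..b}. W \<tau> x = 0 \<and> W' \<tau> x \<noteq> 0}"
  let ?g = "\<lambda>x. (W \<tau> x \<bullet> W' \<tau> x) / norm (W \<tau> x)"
  let ?q = "\<lambda>s x. (norm (W s x) - norm (W \<tau> x)) / (s - \<tau>)"
  have "compact ((\<lambda>(s, x). W' s x) ` ?K)"
    by (intro compact_continuous_image contW' compact_Times) auto
  then obtain C where bound: "\<And>y. y \<in> (\<lambda>(s, x). W' s x) ` ?K \<Longrightarrow> norm y \<le> C"
    using compact_imp_bounded bounded_iff by metis
  then have C: "norm (W' s x) \<le> C" if "\<bar>s - \<tau>\<bar> \<le> \<epsilon>" "x \<in> {a..b}" for s x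
  proof -
    have "(s, x) \<in> ?K"
      using that by (auto simp: abs_le_iff)
    then have "W' s x \<in> (\<lambda>(s, x). W' s x) ` ?K"
      by (rule rev_image_eqI) simp
    then show ?thesis
      by (rule bound)
  qed
  have lipschitz: "norm (W s x - W \<tau> x) \<le> C * \<bar>s - \<tau>\<bar>" if s: "\<bar>s - \<tau>\<bar> \<le> \<epsilon>" and x: "x \<in> {a..b}" for s x
  proof -
    have "norm (W s x - W \<tau> x) \<le> C * norm (s - \<tau>)"
    proof (rule differentiable_bound[of "{\<tau> - \<epsilon>..\<tau> + \<epsilon>}" "\<lambda>s. W s x" "\<lambda>s h. h *\<^sub>R W' s x"])
      fix t assume "t \<in> {\<tau> - \<epsilon>..\<tau> + \<epsilon>}"
      then have t: "\<bar>t - \<tau>\<bar> \<le> \<epsilon>"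
        by (auto simp: abs_le_iff)
      show "((\<lambda>s. W s x) has_derivative (\<lambda>h. h *\<^sub>R W' t x)) (at t within {\<tau> - \<epsilon>..\<tau> + \<epsilon>})"
        using W[OF t x] unfolding has_vector_derivative_def by (rule has_derivative_at_withinI)
      show "onorm (\<lambda>h. h *\<^sub>R W' t x) \<le> C"
        using mult_left_mono[OF C[OF t x] abs_ge_zero] by (intro onorm_le) (simp add: mult.commute)
    qed (use s \<epsilon> in \<open>auto simp: abs_le_iff\<close>)
    then show ?thesis
      by simp
  qed
  have pointwise: "((\<lambda>s. ?q s x) \<longlongrightarrow> ?g x) (at \<tau>)" if x: "x \<in> {a..b}" "x \<notin> ?E" for x
  proof (cases "W \<tau> x = 0")
    case False
    have "((\<lambda>s. norm (W s x)) has_real_derivative ?g x) (at \<tau>)"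
      using has_real_derivative_norm[OF W[of \<tau> x]] False \<epsilon> x by simp
    then show ?thesis
      by (simp add: has_field_derivative_iff)
  next
    case True
    then have W'0: "W' \<tau> x = 0"
      using x by simp
    have "((\<lambda>s. (W s x - W \<tau> x) /\<^sub>R (s - \<tau>)) \<longlongrightarrow> 0) (at \<tau>)"
      using vector_derivative_tendsto_quotient[OF W[of \<tau> x]] \<epsilon> x by (simp add: W'0)
    then have "((\<lambda>s. norm ((W s x - W \<tau> x) /\<^sub>R (s - \<tau>))) \<longlongrightarrow> 0) (at \<tau>)"
      by (rule tendsto_norm_zero)
    moreover have "norm (?q s x) \<le> norm ((W s x - W \<tau> x) /\<^sub>R (s - \<tau>))" for s
      by (simp add: True divide_inverse abs_mult mult.commute)
    ultimately have "((\<lambda>s. ?q s x) \<longlongrightarrow> 0) (at \<tau>)"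
      by (intro Lim_null_comparison[of "\<lambda>s. ?q s x"] always_eventually allI)
    then show ?thesis
      by (simp add: True)
  qed
  have int_norm: "(\<lambda>x. norm (W s x)) integrable_on {a..b}" if "\<bar>s - \<tau>\<bar> \<le> \<epsilon>" for s
    by (intro integrable_continuous_real continuous_on_norm contW that)
  have int_q: "?q s integrable_on {a..b}" if "\<bar>s - \<tau>\<bar> \<le> \<epsilon>" for s
    using int_norm[OF that] int_norm[of \<tau>] \<epsilon> by (intro integrable_on_divide integrable_diff) auto
  have "(\<lambda>n. integral {a..b} (?q (Y n))) \<longlonglongrightarrow> integral {a..b} ?g"
    if Y: "\<And>n. \<bar>Y n - \<tau>\<bar> \<le> \<epsilon>" "\<And>n. Y n \<noteq> \<tau>" "Y \<longlonglongrightarrow> \<tau>" for Y :: "nat \<Rightarrow> real"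
  proof -
    \<comment> \<open>The quotients need not converge on the null set, so they are replaced by \<open>0\<close> there, which is the value of \<open>?g\<close>.\<close>
    let ?f = "\<lambda>n x. if x \<in> ?E then 0 else ?q (Y n) x"
    have spike: "integral {a..b} (?q (Y n)) = integral {a..b} (?f n)" for n
      by (rule integral_spike[OF null]) auto
    have "(\<lambda>n. integral {a..b} (?f n)) \<longlonglongrightarrow> integral {a..b} ?g"
    proof (rule dominated_convergence(2))
      show "?f n integrable_on {a..b}" for n
        by (rule integrable_spike[OF int_q[OF Y(1)] null]) auto
      show "(\<lambda>_. C) integrable_on {a..b}"
        by (simp add: integrable_const_ivl)
      show "norm (?f n x) \<le> C" if "x \<in> {a..b}" for n x
      proof -
        have "\<bar>norm (W (Y n) x) - norm (W \<tau> x)\<bar> \<le> C * \<bar>Y n - \<tau>\<bar>"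
          using norm_triangle_ineq3 lipschitz[OF Y(1) that] by (rule order_trans)
        moreover have "0 \<le> C"
          using C[OF Y(1) that] norm_ge_zero order_trans by blast
        ultimately show ?thesis
          using Y(2)[of n] by (simp add: abs_divide divide_le_eq)
      qed
      show "(\<lambda>n. ?f n x) \<longlonglongrightarrow> ?g x" if "x \<in> {a..b}" for x
      proof (cases "x \<in> ?E")
        case False
        have "filterlim Y (at \<tau>) sequentially"
          using Y by (simp add: filterlim_at)
        then have "(\<lambda>n. ?q (Y n) x) \<longlonglongrightarrow> ?g x"
          by (rule filterlim_compose[OF pointwise[OF that False]])
        then show ?thesis
          by (simp only: False if_False)
      qed simp
    qed
    then show ?thesis
      by (simp only: spike)
  qed
  note along_sequences = this
  have quotient: "(integral {a..b} (\<lambda>x. norm (W s x)) - integral {a..b} (\<lambda>x. norm (W \<tau> x))) / (s - \<tau>) =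
      integral {a..b} (?q s)" if "\<bar>s - \<tau>\<bar> \<le> \<epsilon>" for s
    using int_norm[OF that] int_norm[of \<tau>] \<epsilon>
    by (simp add: Henstock_Kurzweil_Integration.integral_diff)
  show ?thesis
    unfolding has_field_derivative_iff tendsto_at_iff_sequentially comp_def
  proof (intro allI impI)
    fix X :: "nat \<Rightarrow> real" assume X: "\<forall>i. X i \<in> UNIV - {\<tau>}" "X \<longlonglongrightarrow> \<tau>"
    then obtain n0 where n0: "\<And>n. n \<ge> n0 \<Longrightarrow> \<bar>X n - \<tau>\<bar> \<le> \<epsilon>"
      using LIMSEQ_D[OF X(2) \<epsilon>] by (metis less_imp_le real_norm_def)
    have "(\<lambda>n. integral {a..b} (?q (X (n + n0)))) \<longlonglongrightarrow> integral {a..b} ?g"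
      by (rule along_sequences) (use X n0 LIMSEQ_ignore_initial_segment in auto)
    then have "(\<lambda>n. (integral {a..b} (\<lambda>x. norm (W (X (n + n0)) x)) - integral {a..b} (\<lambda>x. norm (W \<tau> x))) /
        (X (n + n0) - \<tau>)) \<longlonglongrightarrow> integral {a..b} ?g"
      by (simp add: quotient n0)
    then show "(\<lambda>n. (integral {a..b} (\<lambda>x. norm (W (X n) x)) - integral {a..b} (\<lambda>x. norm (W \<tau> x))) /
        (X n - \<tau>)) \<longlonglongrightarrow> integral {a..b} ?g"
      by (rule LIMSEQ_offset)
  qed
qed

section \<open>Countable additivity of set integrals\<close>

text \<open>Enumerating the index set, with empty sets for the unused numbers, reduces the claim to integration of a
  series of functions; at each point at most one term of the series is nonzero.\<close>

lemma countable_additivity_set_integral: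
  fixes f :: "'a \<Rightarrow> real"
  assumes A: "countable A" and disj: "disjoint_family_on X A"
    and X: "\<And>i. i \<in> A \<Longrightarrow> X i \<in> sets M"
    and f: "\<And>i. i \<in> A \<Longrightarrow> set_integrable M (X i) f"
    and summ: "(\<lambda>i. LINT x:X i|M. \<bar>f x\<bar>) summable_on A"
  shows "set_integrable M (\<Union>i\<in>A. X i) f"
    and "((\<lambda>i. LINT x:X i|M. f x) has_sum (LINT x:(\<Union>i\<in>A. X i)|M. f x)) A"
proof -
  define K where "K = to_nat_on A ` A"
  define Y where "Y n = (if n \<in> K then X (from_nat_into A n) else {})" for n
  have bij: "bij_betw (to_nat_on A) A K"
    using A by (auto simp: K_def bij_betw_def)
  have YX: "Y (to_nat_on A i) = X i" if "i \<in> A" for i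
    using that A by (simp add: Y_def K_def)
  have UN: "(\<Union>n. Y n) = (\<Union>i\<in>A. X i)"
    using A by (auto simp: Y_def K_def)
  have Yint: "set_integrable M (Y n) f" for n
    using f A by (auto simp: Y_def K_def)
  have Ydisj: "m = n" if "x \<in> Y m" "x \<in> Y n" for m n x
    using that disj A by (auto simp: Y_def K_def disjoint_family_on_def split: if_splits) blast
  have transfer: "(g has_sum s) UNIV \<longleftrightarrow> ((\<lambda>i. g (to_nat_on A i)) has_sum s) A"
    if "\<And>n. n \<notin> K \<Longrightarrow> g n = 0" for g :: "nat \<Rightarrow> real" and s
  proof -
    have "(g has_sum s) UNIV \<longleftrightarrow> (g has_sum s) K"
      by (rule has_sum_cong_neutral) (use that in auto)
    then show ?thesis
      using has_sum_reindex_bij_betw[OF bij, of g s] by simp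
  qed
  have Y_empty: "Y n = {}" if "n \<notin> K" for n
    using that by (simp add: Y_def)
  have abs_summable: "summable (\<lambda>n. LINT x:Y n|M. \<bar>f x\<bar>)"
  proof -
    have "((\<lambda>n. LINT x:Y n|M. \<bar>f x\<bar>) has_sum (\<Sum>\<^sub>\<infinity>i\<in>A. LINT x:X i|M. \<bar>f x\<bar>)) UNIV"
      using has_sum_infsum[OF summ] Y_empty
      by (subst transfer) (auto simp: YX set_lebesgue_integral_def cong: has_sum_cong)
    then show ?thesis
      using has_sum_imp_sums sums_summable by blast
  qed
  have single: "(\<lambda>n. indicator (Y n) x *\<^sub>R f x) sums (indicator (\<Union>n. Y n) x *\<^sub>R f x)" for x
  proof (cases "\<exists>m. x \<in> Y m")
    case True
    then obtain m where m: "x \<in> Y m" by blast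
    then have "indicator (Y n) x = (if n = m then 1 else 0 :: real)" for n
      using Ydisj by (auto simp: indicator_def)
    then have "(\<lambda>n. indicator (Y n) x *\<^sub>R f x) = (\<lambda>n. if n = m then f x else 0)"
      by auto
    then show ?thesis
      using m sums_single[of m "\<lambda>_. f x"] by (auto simp: indicator_def)
  qed simp
  have norm_single: "summable (\<lambda>n. norm (indicator (Y n) x *\<^sub>R f x))" for x
  proof (cases "\<exists>m. x \<in> Y m")
    case True
    then obtain m where m: "x \<in> Y m" by blast
    then have "norm (indicator (Y n) x *\<^sub>R f x) = (if n = m then \<bar>f x\<bar> else 0)" for n
      using Ydisj by (auto simp: indicator_def)
    then show ?thesis
      by simp
  qed simp
  have norm_eq: "(LINT x|M. norm (indicator (Y n) x *\<^sub>R f x)) = (LINT x:Y n|M. \<bar>f x\<bar>)" for n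
    unfolding set_lebesgue_integral_def
    by (rule Bochner_Integration.integral_cong) (auto simp: abs_mult)
  have suminf: "(\<Sum>n. indicator (Y n) x *\<^sub>R f x) = indicator (\<Union>n. Y n) x *\<^sub>R f x" for x
    using single sums_unique by metis
  have "integrable M (\<lambda>x. \<Sum>n. indicator (Y n) x *\<^sub>R f x)"
    by (rule integrable_suminf)
      (use Yint norm_single abs_summable in \<open>simp_all only: set_integrable_def norm_eq always_eventually simp_thms\<close>)
  then show int: "set_integrable M (\<Union>i\<in>A. X i) f"
    unfolding suminf UN[symmetric] set_integrable_def .
  have "(\<lambda>n. integral\<^sup>L M (\<lambda>x. indicator (Y n) x *\<^sub>R f x)) sums
      (LINT x|M. (\<Sum>n. indicator (Y n) x *\<^sub>R f x))"
    by (rule sums_integral)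
      (use Yint norm_single abs_summable in \<open>simp_all only: set_integrable_def norm_eq always_eventually simp_thms\<close>)
  then have sums: "(\<lambda>n. LINT x:Y n|M. f x) sums (LINT x:(\<Union>n. Y n)|M. f x)"
    unfolding suminf by (simp add: set_lebesgue_integral_def)
  have "norm (LINT x:Y n|M. f x) \<le> (LINT x:Y n|M. \<bar>f x\<bar>)" for n
    unfolding norm_eq[symmetric] unfolding set_lebesgue_integral_def
    by (rule integral_norm_bound)
  then have "summable (\<lambda>n. norm (LINT x:Y n|M. f x))"
    by (intro summable_comparison_test'[OF abs_summable]) auto
  then have "((\<lambda>n. LINT x:Y n|M. f x) has_sum (LINT x:(\<Union>n. Y n)|M. f x)) UNIV"
    using sums by (rule norm_summable_imp_has_sum)
  then show "((\<lambda>i. LINT x:X i|M. f x) has_sum (LINT x:(\<Union>i\<in>A. X i)|M. f x)) A"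
    unfolding UN using Y_empty
    by (subst (asm) transfer) (auto simp: YX set_lebesgue_integral_def cong: has_sum_cong)
qed

text \<open>Each finite partial sum is the integral over a finite disjoint union.\<close>

lemma summable_on_set_integral_abs:
  fixes f :: "'a \<Rightarrow> real"
  assumes disj: "disjoint_family_on X A"
    and X: "\<And>i. i \<in> A \<Longrightarrow> X i \<in> sets M"
    and f: "set_integrable M (\<Union>i\<in>A. X i) f"
  shows "(\<lambda>i. LINT x:X i|M. \<bar>f x\<bar>) summable_on A"
proof (rule nonneg_bdd_above_summable_on)
  show "0 \<le> (LINT x:X i|M. \<bar>f x\<bar>)" for i
    by (auto simp: set_lebesgue_integral_def intro!: integral_nonneg_AE)
  have fi: "set_integrable M (X i) f" if "i \<in> A" for i
    by (rule set_integrable_subset[OF f]) (use that X in auto)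
  have "(\<Sum>i\<in>F. LINT x:X i|M. \<bar>f x\<bar>) \<le> (LINT x:(\<Union>i\<in>A. X i)|M. \<bar>f x\<bar>)"
    if F: "F \<subseteq> A" "finite F" for F
  proof -
    have "(\<Sum>i\<in>F. LINT x:X i|M. \<bar>f x\<bar>) = (LINT x:(\<Union>i\<in>F. X i)|M. \<bar>f x\<bar>)"
    proof (rule set_integral_finite_Union[symmetric])
      show "disjoint_family_on X F"
        using disj F by (auto intro: disjoint_family_on_mono)
    qed (use F fi X in \<open>auto intro!: set_integrable_abs\<close>)
    also have "\<dots> \<le> (LINT x:(\<Union>i\<in>A. X i)|M. \<bar>f x\<bar>)"
      unfolding set_lebesgue_integral_def
    proof (rule integral_mono)
      have "set_integrable M (\<Union>i\<in>F. X i) f"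
        by (rule set_integrable_subset[OF f]) (use F X in auto)
      then show "integrable M (\<lambda>x. indicator (\<Union>i\<in>F. X i) x *\<^sub>R \<bar>f x\<bar>)"
        using set_integrable_abs unfolding set_integrable_def by blast
      show "integrable M (\<lambda>x. indicator (\<Union>i\<in>A. X i) x *\<^sub>R \<bar>f x\<bar>)"
        using set_integrable_abs[OF f] unfolding set_integrable_def .
    qed (use F in \<open>auto simp: indicator_def\<close>)
    finally show ?thesis .
  qed
  then show "bdd_above (sum (\<lambda>i. LINT x:X i|M. \<bar>f x\<bar>) ` {F. F \<subseteq> A \<and> finite F})"
    by (intro bdd_aboveI) auto
qed

section \<open>A flux balance across the gaps of a closed set\<close>

text \<open>A conservation law with sources at a closed set \<open>Z\<close>. On each gap \<open>{a<..<b}\<close> of \<open>Z\<close> the flux \<open>F\<close> is a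
  primitive of \<open>f + D\<close>, and its boundary values say that it leaves the gap at both ends; so the integral
  of \<open>f + D\<close> over the gap is \<open>- G b - G a\<close>. Summation over the countably many gaps gives the identity,
  because each point of \<open>Z\<close> with \<open>G \<noteq> 0\<close> is isolated and therefore is the left end of one gap and the right
  end of another. The sign conditions make \<open>D\<close> and \<open>G\<close> dominated by \<open>f\<close>, whence integrability and summability.\<close>

lemma flux_balance:
  fixes F f D G :: "real \<Rightarrow> real"
  assumes ends: "\<alpha> < \<beta>" "\<alpha> \<in> Z" "\<beta> \<in> Z" and Z: "closed Z"
    and f: "f absolutely_integrable_on {\<alpha>..\<beta>}"
    and D_nonneg: "\<And>x. 0 \<le> D x"
    and f_zero: "\<And>x. x \<in> Z \<Longrightarrow> f x = 0" and D_zero: "\<And>x. x \<in> Z \<Longrightarrow> D x = 0"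
    and F: "\<And>x. x \<notin> Z \<Longrightarrow> (F has_real_derivative f x + D x) (at x)"
    and left: "\<And>z. z \<in> Z \<Longrightarrow> (F \<longlongrightarrow> - G z) (at_left z)"
    and right: "\<And>z. z \<in> Z \<Longrightarrow> (F \<longlongrightarrow> G z) (at_right z)"
    and G_nonneg: "\<And>z. 0 \<le> G z"
    and isolated: "\<And>z. z \<in> Z \<Longrightarrow> G z \<noteq> 0 \<Longrightarrow> \<not> z islimpt Z"
  shows "D integrable_on {\<alpha>..\<beta>}"
    and "G summable_on Z \<inter> {\<alpha>..<\<beta>}"
    and "G summable_on Z \<inter> {\<alpha><..\<beta>}"
    and "integral {\<alpha>..\<beta>} D =
      - integral {\<alpha>..\<beta>} f - (\<Sum>\<^sub>\<infinity>z\<in>Z \<inter> {\<alpha>..<\<beta>}. G z) - (\<Sum>\<^sub>\<infinity>z\<in>Z \<inter> {\<alpha><..\<beta>}. G z)"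
proof -
  define C where "C = {p. fst p \<in> Z \<and> snd p \<in> Z \<and> \<alpha> \<le> fst p \<and> fst p < snd p \<and>
    snd p \<le> \<beta> \<and> {fst p<..<snd p} \<inter> Z = {}}"
  define I where "I p = {fst p<..<snd p}" for p :: "real \<times> real"
  have same: "p = q" if "p \<in> C" "q \<in> C" "x \<in> I p" "x \<in> I q" for p q x
  proof -
    have *: "fst p' \<le> fst q' \<and> snd q' \<le> snd p'" if "p' \<in> C" "q' \<in> C" "x \<in> I p'" "x \<in> I q'" for p' q'
    proof -
      have "fst p' \<in> Z" "snd p' \<in> Z" "I q' \<inter> Z = {}"
        using that by (auto simp: C_def I_def)
      then have "fst p' \<notin> I q'" "snd p' \<notin> I q'"
        by blast+
      then show ?thesis
        using that by (auto simp: I_def)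
    qed
    show ?thesis
      using *[of p q] *[of q p] that by (auto intro: prod_eqI)
  qed
  \<comment> \<open>A gap is encoded as the pair of its ends, so that left and right ends are the two projections.\<close>
  have disj: "disjoint_family_on I C"
    using same by (auto simp: disjoint_family_on_def)
  have inj_I: "inj_on I C"
  proof (rule inj_onI)
    fix p q assume pq: "p \<in> C" "q \<in> C" "I p = I q"
    then have "fst p < snd p"
      by (auto simp: C_def)
    then obtain x where "fst p < x" "x < snd p"
      using dense by blast
    then have "x \<in> I p"
      by (simp add: I_def)
    then show "p = q"
      using same pq by blast
  qed
  have "countable (I ` C)"
  proof (rule countable_disjoint_open_subsets)
    show "disjoint (I ` C)"
      using disj by (rule disjoint_family_on_disjoint_image)
  qed (auto simp: I_def)
  then have C_countable: "countable C"
    using inj_I by (rule countable_image_inj_on)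
  have inj_fst: "inj_on fst C"
  proof (rule inj_onI)
    fix p q assume pq: "p \<in> C" "q \<in> C" "fst p = fst q"
    obtain x where "fst p < x" "x < min (snd p) (snd q)"
      using dense[of "fst p" "min (snd p) (snd q)"] pq by (auto simp: C_def)
    then show "p = q"
      using same[of p q x] pq by (simp add: I_def)
  qed
  have inj_snd: "inj_on snd C"
  proof (rule inj_onI)
    fix p q assume pq: "p \<in> C" "q \<in> C" "snd p = snd q"
    obtain x where "max (fst p) (fst q) < x" "x < snd p"
      using dense[of "max (fst p) (fst q)" "snd p"] pq by (auto simp: C_def)
    then show "p = q"
      using same[of p q x] pq by (simp add: I_def)
  qed
  have next_zero: "\<exists>b. b \<in> Z \<and> b \<le> \<beta> \<and> x < b \<and> {x<..<b} \<inter> Z = {}"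
    if x: "\<alpha> \<le> x" "x < \<beta>" and d: "0 < d" "{x<..<x + d} \<inter> Z = {}" for x d
  proof -
    let ?S = "Z \<inter> {x + d..\<beta>}"
    have "compact ?S"
      using Z by (simp add: closed_Int_compact)
    moreover have "\<beta> \<in> ?S"
      using ends x d by force
    ultimately obtain b where b: "b \<in> ?S" "\<And>y. y \<in> ?S \<Longrightarrow> b \<le> y"
      using compact_attains_inf[of ?S] by blast
    have "{x<..<b} \<inter> Z = {}"
      using b d by (fastforce simp: not_le)
    then show ?thesis
      using b d by auto
  qed
  have previous_zero: "\<exists>a. a \<in> Z \<and> \<alpha> \<le> a \<and> a < x \<and> {a<..<x} \<inter> Z = {}"
    if x: "\<alpha> < x" "x \<le> \<beta>" and d: "0 < d" "{x - d<..<x} \<inter> Z = {}" for x d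
  proof -
    let ?S = "Z \<inter> {\<alpha>..x - d}"
    have "compact ?S"
      using Z by (simp add: closed_Int_compact)
    moreover have "\<alpha> \<in> ?S"
      using ends x d by force
    ultimately obtain a where a: "a \<in> ?S" "\<And>y. y \<in> ?S \<Longrightarrow> y \<le> a"
      using compact_attains_sup[of ?S] by blast
    have "{a<..<x} \<inter> Z = {}"
      using a d by (fastforce simp: not_le)
    then show ?thesis
      using a d by auto
  qed
  have UN: "(\<Union>p\<in>C. I p) = {\<alpha><..<\<beta>} - Z"
  proof (intro equalityI subsetI)
    fix x assume x: "x \<in> {\<alpha><..<\<beta>} - Z"
    then obtain d where d: "0 < d" "\<And>y. dist y x < d \<Longrightarrow> y \<notin> Z"
      using Z unfolding closed_def open_dist by (metis Compl_iff DiffD2)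
    have "{x<..<x + d} \<inter> Z = {}" "{x - d<..<x} \<inter> Z = {}"
      using d(2) by (fastforce simp: dist_real_def)+
    obtain b where b: "b \<in> Z" "b \<le> \<beta>" "x < b" "{x<..<b} \<inter> Z = {}"
      using next_zero[of x d] x d \<open>{x<..<x + d} \<inter> Z = {}\<close> by auto
    obtain a where a: "a \<in> Z" "\<alpha> \<le> a" "a < x" "{a<..<x} \<inter> Z = {}"
      using previous_zero[of x d] x d \<open>{x - d<..<x} \<inter> Z = {}\<close> by auto
    have "{a<..<b} \<inter> Z = {}"
      using a(4) b(4) x by (auto simp: set_eq_iff) (metis linorder_neqE_linordered_idom)
    then have "(a, b) \<in> C"
      using a b by (simp add: C_def)
    then show "x \<in> (\<Union>p\<in>C. I p)"
      using a b by (force simp: I_def)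
  qed (auto simp: C_def I_def)
  have f_sub: "f absolutely_integrable_on S" if "S \<in> sets lebesgue" "S \<subseteq> {\<alpha>..\<beta>}" for S
    using set_integrable_subset[OF f] that by blast
  have gap: "D absolutely_integrable_on I p \<and>
      (LINT x:I p|lebesgue. D x) = - (LINT x:I p|lebesgue. f x) - G (fst p) - G (snd p)"
    if p: "p \<in> C" for p
  proof -
    obtain a b where ab: "p = (a, b)" "a \<in> Z" "b \<in> Z" "\<alpha> \<le> a" "a < b" "b \<le> \<beta>" "{a<..<b} \<inter> Z = {}"
      using p by (cases p) (simp add: C_def)
    \<comment> \<open>The function \<open>F\<close> on the open gap, extended continuously to the ends by the one-sided limits.\<close>
    define E where "E x = (if x \<le> a then G a else if b \<le> x then - G b else F x)" for x
    have E_inner: "E y = F y" if "a < y" "y < b" for y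
      using that by (simp add: E_def)
    have E_eq: "\<forall>\<^sub>F y in nhds x. F y = E y" if "a < x" "x < b" for x
    proof -
      have "\<forall>\<^sub>F y in nhds x. y \<in> {a<..<b}"
        using that by (intro eventually_nhds_in_open) auto
      then show ?thesis
        by (rule eventually_mono) (simp add: E_inner)
    qed
    have E_deriv: "(E has_real_derivative f x + D x) (at x)" if "a < x" "x < b" for x
    proof -
      have "x \<notin> Z"
        using that ab(7) by auto
      then have "(F has_real_derivative f x + D x) (at x)"
        by (rule F)
      then show ?thesis
        by (rule DERIV_cong_ev[OF refl E_eq[OF that] refl, THEN iffD1])
    qed
    have "continuous_on {a..b} E"
    proof (rule continuous_on_IccI)
      have "(F \<longlongrightarrow> E a) (at_right a)"
        using right[OF \<open>a \<in> Z\<close>] by (simp add: E_def)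
      moreover have "\<forall>\<^sub>F x in at_right a. F x = E x"
        using \<open>a < b\<close> by (intro eventually_at_rightI[of a b]) (auto simp: E_def)
      ultimately show "(E \<longlongrightarrow> E a) (at_right a)"
        by (rule Lim_transform_eventually)
      have "(F \<longlongrightarrow> E b) (at_left b)"
        using left[OF \<open>b \<in> Z\<close>] \<open>a < b\<close> by (simp add: E_def)
      moreover have "\<forall>\<^sub>F x in at_left b. F x = E x"
        using \<open>a < b\<close> by (intro eventually_at_leftI[of a b]) (auto simp: E_def)
      ultimately show "(E \<longlongrightarrow> E b) (at_left b)"
        by (rule Lim_transform_eventually)
    qed (use E_deriv DERIV_isCont ab in \<open>auto simp: isCont_def\<close>)
    then have "((\<lambda>x. f x + D x) has_integral E b - E a) {a..b}"
      using E_deriv ab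
      by (intro fundamental_theorem_of_calculus_interior)
        (auto simp: has_real_derivative_iff_has_vector_derivative)
    then have total: "((\<lambda>x. f x + D x) has_integral - G b - G a) {a..b}"
      using ab by (simp add: E_def)
    have f_ab: "f integrable_on {a..b}"
      using f_sub[of "{a..b}"] ab set_lebesgue_integral_eq_integral(1) by auto
    have D_int: "(D has_integral - G b - G a - integral {a..b} f) {a..b}"
      using has_integral_diff[OF total integrable_integral[OF f_ab]] by simp
    then have "D absolutely_integrable_on {a..b}"
      using D_nonneg by (intro nonnegative_absolutely_integrable_1) auto
    then have D_ab: "D absolutely_integrable_on {a<..<b}"
      by (rule set_integrable_subset) auto
    moreover have "(LINT x:{a<..<b}|lebesgue. D x) = integral {a..b} D"
      using set_lebesgue_integral_eq_integral(2)[OF D_ab] by (simp add: integral_open_interval_real)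
    moreover have "(LINT x:{a<..<b}|lebesgue. f x) = integral {a..b} f"
    proof -
      have "{a<..<b} \<subseteq> {\<alpha>..\<beta>}"
        using ab by auto
      then show ?thesis
        using set_lebesgue_integral_eq_integral(2)[OF f_sub[of "{a<..<b}"]]
        by (simp add: integral_open_interval_real)
    qed
    ultimately show ?thesis
      using D_int ab by (simp add: I_def integral_unique)
  qed
  have I_sets: "I p \<in> sets lebesgue" for p
    by (simp add: I_def)
  have f_UN: "f absolutely_integrable_on (\<Union>p\<in>C. I p)"
    unfolding UN by (rule f_sub) (use Z in auto)
  have f_abs: "(\<lambda>p. LINT x:I p|lebesgue. \<bar>f x\<bar>) summable_on C"
    by (rule summable_on_set_integral_abs[OF disj I_sets f_UN])
  have f_I: "f absolutely_integrable_on I p" if "p \<in> C" for p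
    by (rule set_integrable_subset[OF f_UN]) (use that I_sets in auto)
  have f_sum: "((\<lambda>p. LINT x:I p|lebesgue. f x) has_sum (LINT x:(\<Union>p\<in>C. I p)|lebesgue. f x)) C"
    by (rule countable_additivity_set_integral(2)[OF C_countable disj I_sets f_I f_abs])
  \<comment> \<open>The boundary terms of a gap have the good sign, so the integral of \<open>D\<close> is at most that of \<open>- f\<close>.\<close>
  have D_le: "(LINT x:I p|lebesgue. D x) \<le> (LINT x:I p|lebesgue. \<bar>f x\<bar>)" if "p \<in> C" for p
  proof -
    have "norm (LINT x:I p|lebesgue. f x) \<le> (LINT x:I p|lebesgue. norm (f x))"
      by (rule set_integral_norm_bound[OF f_I[OF that]])
    then show ?thesis
      using gap[OF that] G_nonneg[of "fst p"] G_nonneg[of "snd p"] by (simp add: abs_le_iff)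
  qed
  have "(\<lambda>p. LINT x:I p|lebesgue. D x) summable_on C"
    using f_abs
  proof (rule summable_on_comparison_test)
    show "0 \<le> (LINT x:I p|lebesgue. D x)" for p
      using D_nonneg by (auto simp: set_lebesgue_integral_def intro!: integral_nonneg_AE)
  qed (use D_le in auto)
  then have D_abs: "(\<lambda>p. LINT x:I p|lebesgue. \<bar>D x\<bar>) summable_on C"
    using D_nonneg by simp
  have D_I: "D absolutely_integrable_on I p" if "p \<in> C" for p
    using gap that by blast
  have D_UN: "D absolutely_integrable_on (\<Union>p\<in>C. I p)"
    "((\<lambda>p. LINT x:I p|lebesgue. D x) has_sum (LINT x:(\<Union>p\<in>C. I p)|lebesgue. D x)) C"
    by (rule countable_additivity_set_integral[OF C_countable disj I_sets D_I D_abs]; assumption)+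
  \<comment> \<open>Passing from the union of the gaps to the whole interval costs nothing, as \<open>f\<close> and \<open>D\<close> vanish on \<open>Z\<close>.\<close>
  have extend: "indicator (\<Union>p\<in>C. I p) x *\<^sub>R g x = indicator {\<alpha>..\<beta>} x *\<^sub>R g x"
    if "\<And>x. x \<in> Z \<Longrightarrow> g x = 0" for g :: "real \<Rightarrow> real" and x
    unfolding UN using that ends by (cases "x = \<alpha> \<or> x = \<beta>") (auto simp: indicator_def)
  have extend_D: "indicator (\<Union>p\<in>C. I p) x *\<^sub>R D x = indicator {\<alpha>..\<beta>} x *\<^sub>R D x" for x
    by (rule extend) (rule D_zero)
  have extend_f: "indicator (\<Union>p\<in>C. I p) x *\<^sub>R f x = indicator {\<alpha>..\<beta>} x *\<^sub>R f x" for x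
    by (rule extend) (rule f_zero)
  have D_int: "D absolutely_integrable_on {\<alpha>..\<beta>}"
    using D_UN(1) unfolding set_integrable_def extend_D .
  have D_total: "(LINT x:(\<Union>p\<in>C. I p)|lebesgue. D x) = integral {\<alpha>..\<beta>} D"
    using set_lebesgue_integral_eq_integral(2)[OF D_int]
    unfolding set_lebesgue_integral_def extend_D .
  have f_total: "(LINT x:(\<Union>p\<in>C. I p)|lebesgue. f x) = integral {\<alpha>..\<beta>} f"
    using set_lebesgue_integral_eq_integral(2)[OF f]
    unfolding set_lebesgue_integral_def extend_f .
  show "D integrable_on {\<alpha>..\<beta>}"
    using D_int set_lebesgue_integral_eq_integral(1) by blast
  have "((\<lambda>p. - (LINT x:I p|lebesgue. f x) + - (LINT x:I p|lebesgue. D x)) has_sum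
      - integral {\<alpha>..\<beta>} f + - integral {\<alpha>..\<beta>} D) C"
    using f_sum D_UN(2) unfolding f_total D_total
    by (intro has_sum_add) (simp_all add: has_sum_uminus)
  then have "((\<lambda>p. G (snd p) + G (fst p)) has_sum - integral {\<alpha>..\<beta>} f + - integral {\<alpha>..\<beta>} D) C"
    by (simp add: gap cong: has_sum_cong)
  then have GG: "((\<lambda>p. G (fst p) + G (snd p)) has_sum - integral {\<alpha>..\<beta>} f - integral {\<alpha>..\<beta>} D) C"
    by (simp only: add.commute diff_conv_add_uminus)
  have fst_summable: "(\<lambda>p. G (fst p)) summable_on C" and snd_summable: "(\<lambda>p. G (snd p)) summable_on C"
    by (rule summable_on_comparison_test[OF has_sum_imp_summable[OF GG]]; use G_nonneg in simp)+
  have isolated_gap: "\<exists>d>0. {x - d<..<x} \<inter> Z = {} \<and> {x<..<x + d} \<inter> Z = {}"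
    if x: "x \<in> Z" "G x \<noteq> 0" for x
  proof -
    obtain d where d: "0 < d" "\<And>y. y \<in> Z \<Longrightarrow> y \<noteq> x \<Longrightarrow> d \<le> dist y x"
      using isolated[OF x] unfolding islimpt_approachable by (meson not_le)
    have "y \<notin> Z" if "y \<in> {x - d<..<x} \<union> {x<..<x + d}" for y
      using d(2)[of y] that by (auto simp: dist_real_def)
    then show ?thesis
      using d(1) by blast
  qed
  \<comment> \<open>Points of \<open>Z\<close> that are not the left end of a gap are limits of \<open>Z\<close> from the right, and \<open>G\<close> vanishes there.\<close>
  have fst_sum: "((\<lambda>p. G (fst p)) has_sum s) C \<longleftrightarrow> (G has_sum s) (Z \<inter> {\<alpha>..<\<beta>})" for s
  proof -
    have "((\<lambda>p. G (fst p)) has_sum s) C \<longleftrightarrow> (G has_sum s) (fst ` C)"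
      using has_sum_reindex[OF inj_fst, of G s] by (simp add: comp_def)
    also have "\<dots> \<longleftrightarrow> (G has_sum s) (Z \<inter> {\<alpha>..<\<beta>})"
    proof (rule has_sum_cong_neutral)
      fix x assume x: "x \<in> (Z \<inter> {\<alpha>..<\<beta>}) - fst ` C"
      show "G x = 0"
      proof (rule ccontr)
        assume "G x \<noteq> 0"
        then obtain d where d: "0 < d" "{x<..<x + d} \<inter> Z = {}"
          using isolated_gap x by blast
        then obtain b where "b \<in> Z" "b \<le> \<beta>" "x < b" "{x<..<b} \<inter> Z = {}"
          using next_zero[of x d] x d by auto
        then have "(x, b) \<in> C"
          using x by (simp add: C_def)
        then show False
          using x by force
      qed
    qed (auto simp: C_def)
    finally show ?thesis .
  qed
  have snd_sum: "((\<lambda>p. G (snd p)) has_sum s) C \<longleftrightarrow> (G has_sum s) (Z \<inter> {\<alpha><..\<beta>})" for s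
  proof -
    have "((\<lambda>p. G (snd p)) has_sum s) C \<longleftrightarrow> (G has_sum s) (snd ` C)"
      using has_sum_reindex[OF inj_snd, of G s] by (simp add: comp_def)
    also have "\<dots> \<longleftrightarrow> (G has_sum s) (Z \<inter> {\<alpha><..\<beta>})"
    proof (rule has_sum_cong_neutral)
      fix x assume x: "x \<in> (Z \<inter> {\<alpha><..\<beta>}) - snd ` C"
      show "G x = 0"
      proof (rule ccontr)
        assume "G x \<noteq> 0"
        then obtain d where d: "0 < d" "{x - d<..<x} \<inter> Z = {}"
          using isolated_gap x by blast
        then obtain a where "a \<in> Z" "\<alpha> \<le> a" "a < x" "{a<..<x} \<inter> Z = {}"
          using previous_zero[of x d] x d by auto
        then have "(a, x) \<in> C"
          using x by (simp add: C_def)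
        then show False
          using x by force
      qed
    qed (auto simp: C_def)
    finally show ?thesis .
  qed
  show "G summable_on Z \<inter> {\<alpha>..<\<beta>}" and "G summable_on Z \<inter> {\<alpha><..\<beta>}"
    using fst_summable snd_summable unfolding summable_on_def fst_sum snd_sum .
  have "(G has_sum infsum (\<lambda>p. G (fst p)) C) (Z \<inter> {\<alpha>..<\<beta>})"
    using has_sum_infsum[OF fst_summable] unfolding fst_sum .
  moreover have "(G has_sum infsum (\<lambda>p. G (snd p)) C) (Z \<inter> {\<alpha><..\<beta>})"
    using has_sum_infsum[OF snd_summable] unfolding snd_sum .
  moreover have "- integral {\<alpha>..\<beta>} f - integral {\<alpha>..\<beta>} D =
      infsum (\<lambda>p. G (fst p)) C + infsum (\<lambda>p. G (snd p)) C"
    using infsumI[OF GG] infsum_add[OF fst_summable snd_summable] by simp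
  ultimately show "integral {\<alpha>..\<beta>} D =
      - integral {\<alpha>..\<beta>} f - (\<Sum>\<^sub>\<infinity>z\<in>Z \<inter> {\<alpha>..<\<beta>}. G z) - (\<Sum>\<^sub>\<infinity>z\<in>Z \<inter> {\<alpha><..\<beta>}. G z)"
    by (simp add: infsumI)
qed

lemma has_integral_periodic_shift:
  fixes f :: "real \<Rightarrow> real"
  assumes P: "\<And>x. f (x + P) = f x" and x0: "0 \<le> x0" "x0 \<le> P"
    and I: "(f has_integral I) {x0..x0 + P}"
  shows "(f has_integral I) {0..P}"
proof -
  have i1: "f integrable_on {x0..P}" and i2: "f integrable_on {P..x0 + P}"
    by (rule integrable_subinterval_real[OF has_integral_integrable[OF I]]; use x0 in auto)+
  have "I = integral {x0..P} f + integral {P..x0+P} f"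
    using x0 I has_integral_integrable[OF I]
    by (subst Henstock_Kurzweil_Integration.integral_combine) (auto simp: integral_unique)
  have "(f has_integral integral {P..x0+P} f) (cbox P (x0 + P))"
    using i2 by (simp add: integrable_integral)
  from has_integral_affinity[OF this, of 1 P] have "(f has_integral integral {P..x0+P} f) {0..x0}"
    using P by (simp add: image_affinity_atLeastAtMost_diff)
  then have "(f has_integral integral {P..x0+P} f + integral {x0..P} f) {0..P}"
    using x0 i1 by (intro has_integral_combine[of 0 x0 P]) auto
  then show ?thesis
    by (simp add: add.commute \<open>I = _\<close>)
qed

text \<open>If \<open>Z\<close> is nonempty, the balance over one period starting at a point of \<open>Z\<close> counts this point at both
  ends, once as a left and once as a right end of a gap, like every other point.\<close>

lemma periodic_flux_balance:
  fixes F f D G :: "real \<Rightarrow> real"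
  assumes P: "0 < P"
    and periodic: "\<And>x. F (x + P) = F x" "\<And>x. f (x + P) = f x" "\<And>x. D (x + P) = D x"
      "\<And>x. G (x + P) = G x" "\<And>x. x + P \<in> Z \<longleftrightarrow> x \<in> Z"
    and Z: "closed Z"
    and f: "\<And>a b. f absolutely_integrable_on {a..b}"
    and D_nonneg: "\<And>x. 0 \<le> D x"
    and f_zero: "\<And>x. x \<in> Z \<Longrightarrow> f x = 0" and D_zero: "\<And>x. x \<in> Z \<Longrightarrow> D x = 0"
    and F: "\<And>x. x \<notin> Z \<Longrightarrow> (F has_real_derivative f x + D x) (at x)"
    and left: "\<And>z. z \<in> Z \<Longrightarrow> (F \<longlongrightarrow> - G z) (at_left z)"
    and right: "\<And>z. z \<in> Z \<Longrightarrow> (F \<longlongrightarrow> G z) (at_right z)"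
    and G_nonneg: "\<And>z. 0 \<le> G z"
    and isolated: "\<And>z. z \<in> Z \<Longrightarrow> G z \<noteq> 0 \<Longrightarrow> \<not> z islimpt Z"
  shows "D integrable_on {0..P}"
    and "G summable_on Z \<inter> {0..<P}"
    and "integral {0..P} D = - integral {0..P} f - 2 * (\<Sum>\<^sub>\<infinity>z\<in>Z \<inter> {0..<P}. G z)"
proof -
  have "D integrable_on {0..P} \<and> G summable_on Z \<inter> {0..<P} \<and>
    integral {0..P} D = - integral {0..P} f - 2 * (\<Sum>\<^sub>\<infinity>z\<in>Z \<inter> {0..<P}. G z)"
  proof (cases "Z = {}")
    case True
    have "((\<lambda>x. f x + D x) has_integral F P - F 0) {0..P}"
    proof (rule fundamental_theorem_of_calculus)
      show "(F has_vector_derivative f x + D x) (at x within {0..P})" for x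
        using F[of x] True
        by (simp add: has_real_derivative_iff_has_vector_derivative has_vector_derivative_at_within)
    qed (use P in simp)
    then have fD: "((\<lambda>x. f x + D x) has_integral 0) {0..P}"
      using periodic(1)[of 0] by simp
    have f_int: "f integrable_on {0..P}"
      using f by (rule set_lebesgue_integral_eq_integral(1))
    have "(D has_integral - integral {0..P} f) {0..P}"
      using has_integral_diff[OF fD integrable_integral[OF f_int]] by simp
    then show ?thesis
      using has_integral_integrable integral_unique by (auto simp: True)
  next
    case False
    then obtain z where z: "z \<in> Z"
      by blast
    \<comment> \<open>A point of \<open>Z\<close> in the first period.\<close>
    define x0 where "x0 = z - of_int \<lfloor>z / P\<rfloor> * P"
    interpret periodic_fun_simple "\<lambda>x. x \<in> Z" P
      using periodic(5) by unfold_locales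
    have x0_Z: "x0 \<in> Z"
      using z minus_of_int[of z "\<lfloor>z / P\<rfloor>"] by (simp add: x0_def)
    have x0: "0 \<le> x0" "x0 < P"
      using floor_divide_lower[OF P, of z] floor_divide_upper[OF P, of z]
      by (simp_all add: x0_def algebra_simps)
    note balance = flux_balance[of x0 "x0 + P" Z f D F G]
    have D: "D integrable_on {x0..x0 + P}"
      and sum1: "G summable_on Z \<inter> {x0..<x0 + P}" and sum2: "G summable_on Z \<inter> {x0<..x0 + P}"
      and eq: "integral {x0..x0 + P} D = - integral {x0..x0 + P} f -
        (\<Sum>\<^sub>\<infinity>z\<in>Z \<inter> {x0..<x0 + P}. G z) - (\<Sum>\<^sub>\<infinity>z\<in>Z \<inter> {x0<..x0 + P}. G z)"
      using P x0_Z periodic(5) Z f D_nonneg f_zero D_zero F left right G_nonneg isolated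
      by (auto intro!: balance)
    have G_back: "G (x - P) = G x" and Z_back: "x - P \<in> Z \<longleftrightarrow> x \<in> Z" for x
      using periodic(4,5)[of "x - P"] by simp_all
    \<comment> \<open>The part of the shifted period that sticks out beyond \<open>P\<close> is moved back by one period.\<close>
    have tr1: "(G has_sum s) (Z \<inter> {x0..<x0 + P}) \<longleftrightarrow> (G has_sum s) (Z \<inter> {0..<P})" for s
      by (rule has_sum_reindex_bij_witness[where j = "\<lambda>x. if x < P then x else x - P"
            and i = "\<lambda>y. if y < x0 then y + P else y"])
        (use x0 in \<open>auto simp: periodic G_back Z_back\<close>)
    have tr2: "(G has_sum s) (Z \<inter> {x0<..x0 + P}) \<longleftrightarrow> (G has_sum s) (Z \<inter> {0..<P})" for s
      by (rule has_sum_reindex_bij_witness[where j = "\<lambda>x. if x < P then x else x - P"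
            and i = "\<lambda>y. if y \<le> x0 then y + P else y"])
        (use x0 in \<open>auto simp: periodic G_back Z_back\<close>)
    have s0: "G summable_on Z \<inter> {0..<P}"
      using sum1 unfolding summable_on_def tr1 .
    have "(\<Sum>\<^sub>\<infinity>z\<in>Z \<inter> {x0..<x0 + P}. G z) = (\<Sum>\<^sub>\<infinity>z\<in>Z \<inter> {0..<P}. G z)"
      "(\<Sum>\<^sub>\<infinity>z\<in>Z \<inter> {x0<..x0 + P}. G z) = (\<Sum>\<^sub>\<infinity>z\<in>Z \<inter> {0..<P}. G z)"
      using has_sum_infsum[OF s0] tr1 tr2 by (auto intro!: infsumI)
    moreover have D0: "(D has_integral integral {x0..x0 + P} D) {0..P}"
      by (rule has_integral_periodic_shift[of D, OF periodic(3)])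
        (use x0 D in \<open>auto simp: integrable_integral\<close>)
    moreover have "f integrable_on {x0..x0 + P}"
      using f by (rule set_lebesgue_integral_eq_integral(1))
    then have "(f has_integral integral {x0..x0 + P} f) {0..P}"
      by (intro has_integral_periodic_shift[of f, OF periodic(2)])
        (use x0 in \<open>auto simp: integrable_integral\<close>)
    ultimately show ?thesis
      using s0 eq integral_unique[of D] integral_unique[of f] has_integral_integrable[OF D0] by simp
  qed
  then show "D integrable_on {0..P}"
    and "G summable_on Z \<inter> {0..<P}"
    and "integral {0..P} D = - integral {0..P} f - 2 * (\<Sum>\<^sub>\<infinity>z\<in>Z \<inter> {0..<P}. G z)"
    by blast+
qed

section \<open>The flux identity for a curve moving by curvature\<close>

text \<open>The scalar identity behind \<open>flux_deriv\<close>. The letters stand for \<open>n = |p \<times> q|\<close>, \<open>m = |p|\<^sup>2\<close>, \<open>Q = |q|\<^sup>2\<close>,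
  \<open>s = p \<bullet> q\<close>, \<open>u = p \<bullet> N\<close>, \<open>v = (p \<times> q) \<bullet> N\<close>, \<open>a = (p \<times> r) \<bullet> (p \<times> N)\<close>,
  \<open>b = (p \<times> q) \<bullet> (p \<times> r)\<close> and \<open>c = (p \<times> q) \<bullet> (p \<times> M)\<close>. The left side is the derivative of the flux by the
  quotient rule, with the numerator \<open>- u s\<close> of the flux inserted; the first summand of the right side is the
  rate of the speed of the projected curve and the second is the dissipation.\<close>

lemma flux_algebra:
  fixes n m Q s u v a b c :: real
  assumes "n \<noteq> 0" "m \<noteq> 0" and lagrange: "n\<^sup>2 = m * Q - s\<^sup>2"
    and triple: "a * n\<^sup>2 = Q * v\<^sup>2 * m - u * s * b"
  shows "((a - u * Q + c) * (n * m) + u * s * (b / n * m + n * (2 * s))) / ((n * m) * (n * m)) =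
    ((n\<^sup>2 + u * Q + c) / m - (m + 2 * u) / m\<^sup>2 * n\<^sup>2) / n + Q * v\<^sup>2 / n ^ 3" (is "?L = ?R")
proof -
  have "?L * (n ^ 3 * m\<^sup>2) = (a * n\<^sup>2) * m + (c - u * Q) * n\<^sup>2 * m + u * s * b * m + 2 * u * s\<^sup>2 * n\<^sup>2"
    using assms(1,2) by (simp add: field_simps power2_eq_square power3_eq_cube)
  also have "\<dots> = n\<^sup>2 * ((n\<^sup>2 + u * Q + c) * m - (m + 2 * u) * n\<^sup>2) + Q * v\<^sup>2 * m\<^sup>2"
    unfolding triple using lagrange by algebra
  also have "\<dots> = ?R * (n ^ 3 * m\<^sup>2)"
    using assms(1,2) by (simp add: field_simps power2_eq_square power3_eq_cube)
  finally have "?L * (n ^ 3 * m\<^sup>2) = ?R * (n ^ 3 * m\<^sup>2)" .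
  moreover have "n ^ 3 * m\<^sup>2 \<noteq> 0"
    using assms(1,2) by simp
  ultimately show ?thesis
    using mult_right_cancel by blast
qed

text \<open>One time slice of the flow: position \<open>p\<close>, its first two derivatives \<open>q\<close> and \<open>r\<close> in the curve parameter,
  the curvature vector \<open>N\<close> and its derivative \<open>M\<close>. The latter two are parameters because the flow yields
  them as time derivatives of \<open>p\<close> and \<open>q\<close>, up to the scaling part.\<close>

locale radial_curve =
  fixes p q r N M :: "real \<Rightarrow> real^3"
  assumes p_deriv: "(p has_vector_derivative q x) (at x)"
    and q_deriv: "(q has_vector_derivative r x) (at x)"
    and N_deriv: "(N has_vector_derivative M x) (at x)"
    and p_nonzero: "p x \<noteq> 0"
    and q_nonzero: "q x \<noteq> 0"
    and N_eq: "N x = (1 / norm (q x) ^ 4) *\<^sub>R cross3 (q x) (cross3 (r x) (q x))"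
begin

definition areal :: "real \<Rightarrow> real^3" where
  "areal x = cross3 (p x) (q x)"

text \<open>With \<open>u = p / |p|\<close> this is \<open>u \<times> u'\<close>; its norm is the speed of \<open>u\<close>, and unlike the speed it is smooth
  at the zeros of \<open>u'\<close>.\<close>

definition angular :: "real \<Rightarrow> real^3" where
  "angular x = (1 / (norm (p x))\<^sup>2) *\<^sub>R areal x"

text \<open>The time derivative of \<open>angular\<close> when \<open>p\<close> moves with velocity \<open>p / 2 + N\<close> and hence \<open>q\<close> with velocity
  \<open>q / 2 + M\<close>.\<close>

definition angular_rate :: "real \<Rightarrow> real^3" where
  "angular_rate x = (1 / (norm (p x))\<^sup>2) *\<^sub>R (areal x + cross3 (N x) (q x) + cross3 (p x) (M x)) -
     (((norm (p x))\<^sup>2 + 2 * (p x \<bullet> N x)) / norm (p x) ^ 4) *\<^sub>R areal x"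

definition length_rate :: "real \<Rightarrow> real" where
  "length_rate x = (angular x \<bullet> angular_rate x) / norm (angular x)"

text \<open>The component of \<open>N\<close> in the direction of \<open>u'\<close>, divided by \<open>|p|\<close>.\<close>

definition flux :: "real \<Rightarrow> real" where
  "flux x = (areal x \<bullet> cross3 (p x) (N x)) / (norm (areal x) * (norm (p x))\<^sup>2)"

definition dissipation :: "real \<Rightarrow> real" where
  "dissipation x = (norm (q x))\<^sup>2 * (areal x \<bullet> N x)\<^sup>2 / norm (areal x) ^ 3"

text \<open>The size of the flux at a cusp of the projected curve.\<close>

definition kink :: "real \<Rightarrow> real" where
  "kink x = norm (N x) / norm (p x)"

definition radial_set :: "real set" where
  "radial_set = {x. areal x = 0}"

text \<open>The part of \<open>r\<close> orthogonal to \<open>q\<close>, divided by \<open>|q|\<^sup>2\<close>.\<close>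

lemma N_expand: "N x = (1 / (q x \<bullet> q x)) *\<^sub>R r x - ((q x \<bullet> r x) / (q x \<bullet> q x)\<^sup>2) *\<^sub>R q x"
proof -
  have n4: "norm (q x) ^ 4 = (q x \<bullet> q x)\<^sup>2"
    by (simp add: power2_norm_eq_inner[symmetric] power_mult[symmetric])
  have "q x \<bullet> q x \<noteq> 0"
    using q_nonzero by simp
  then show ?thesis
    unfolding N_eq n4 Lagrange
    by (simp add: scaleR_diff_right power2_eq_square)
qed

lemma q_N: "q x \<bullet> N x = 0"
  by (simp add: N_eq dot_cross_self)

lemma cross_p_r:
  assumes "x \<in> radial_set"
  shows "cross3 (p x) (r x) = (q x \<bullet> q x) *\<^sub>R cross3 (p x) (N x)"
proof -
  have "cross3 (p x) (N x) = (1 / (q x \<bullet> q x)) *\<^sub>R cross3 (p x) (r x)"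
    using assms by (simp add: N_expand Cross3.right_diff_distrib cross_mult_right radial_set_def areal_def)
  then show ?thesis
    using q_nonzero by simp
qed

lemma p_N:
  assumes "x \<in> radial_set"
  shows "p x \<bullet> N x = 0"
proof -
  have "(p x \<bullet> N x) * (q x \<bullet> q x) = 0"
    using dot_cross[of "p x" "q x" "N x" "q x"] q_N[of x] assms
    by (simp add: radial_set_def areal_def inner_commute)
  then show ?thesis
    using q_nonzero by simp
qed

text \<open>At a radial point \<open>p\<close> is parallel to \<open>q\<close> and hence orthogonal to \<open>N\<close>.\<close>

lemma norm_cross_p_N:
  assumes "x \<in> radial_set"
  shows "norm (cross3 (p x) (N x)) = norm (p x) * norm (N x)"
proof -
  have "(norm (cross3 (p x) (N x)))\<^sup>2 = (norm (p x) * norm (N x))\<^sup>2"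
    by (simp add: norm_cross p_N[OF assms] power_mult_distrib)
  then show ?thesis
    by (simp add: power2_eq_iff_nonneg)
qed

lemma areal_deriv: "(areal has_vector_derivative cross3 (p x) (r x)) (at x)"
  using has_vector_derivative_cross3[OF p_deriv q_deriv, of x]
  unfolding areal_def[abs_def] by simp

lemma continuous_areal: "continuous_on S areal"
  using areal_deriv has_vector_derivative_at_within
  by (intro continuous_on_vector_derivative) blast

lemma closed_radial_set: "closed radial_set"
  unfolding radial_set_def by (intro closed_Collect_eq continuous_areal continuous_on_const)

lemma norm_angular: "norm (angular x) = norm (areal x) / (norm (p x))\<^sup>2"
  by (simp add: angular_def)

text \<open>The first variation formula for the length of the projected curve. Besides the Lagrange identity, the only
  geometric input is that \<open>(p \<times> q) \<times> (p \<times> r)\<close> and \<open>(p \<times> q) \<times> (p \<times> N)\<close> are both multiples of \<open>p\<close>, by factors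
  that agree up to \<open>|q|\<^sup>2\<close>; their product is the square in the dissipation.\<close>

lemma flux_deriv:
  assumes x: "x \<notin> radial_set"
  shows "(flux has_real_derivative length_rate x + dissipation x) (at x)"
proof -
  let ?n = "norm (areal x)" and ?m = "(norm (p x))\<^sup>2" and ?Q = "q x \<bullet> q x" and ?s = "p x \<bullet> q x"
  let ?u = "p x \<bullet> N x" and ?v = "areal x \<bullet> N x" and ?V' = "cross3 (p x) (r x)"
  let ?a = "?V' \<bullet> cross3 (p x) (N x)" and ?b = "areal x \<bullet> ?V'" and ?c = "areal x \<bullet> cross3 (p x) (M x)"
  have n: "?n \<noteq> 0" and m: "?m \<noteq> 0"
    using x p_nonzero by (auto simp: radial_set_def)
  have lagrange: "?n\<^sup>2 = ?m * ?Q - ?s\<^sup>2"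
    unfolding areal_def norm_cross by (simp add: power2_norm_eq_inner)
  have V_pN: "areal x \<bullet> cross3 (p x) (N x) = - (?u * ?s)"
    using q_N[of x] by (simp add: areal_def dot_cross inner_commute)
  have V_qN: "areal x \<bullet> cross3 (q x) (N x) = - (?u * ?Q)"
    using q_N[of x] by (simp add: areal_def dot_cross inner_commute)
  have V_Nq: "areal x \<bullet> cross3 (N x) (q x) = ?u * ?Q"
    using V_qN by (subst cross_skew) simp
  have V_r: "areal x \<bullet> r x = ?Q * ?v"
    using q_nonzero[of x] by (simp add: N_expand inner_diff_right areal_def dot_cross_self)
  have triple: "?a * ?n\<^sup>2 = ?Q * ?v\<^sup>2 * ?m - ?u * ?s * ?b"
  proof -
    have "p x \<bullet> cross3 (q x) y = areal x \<bullet> y" for y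
      unfolding areal_def cross_triple[of "p x" "q x" y] by (rule inner_commute)
    then have "cross3 (areal x) ?V' = (areal x \<bullet> r x) *\<^sub>R p x" "cross3 (areal x) (cross3 (p x) (N x)) = ?v *\<^sub>R p x"
      by (simp_all add: areal_def[of x] cross_cross_det dot_cross_det[symmetric] dot_cross_self)
    then have "cross3 (areal x) ?V' \<bullet> cross3 (areal x) (cross3 (p x) (N x)) = (areal x \<bullet> r x) * ?v * ?m"
      by (simp add: power2_norm_eq_inner)
    moreover have "cross3 (areal x) ?V' \<bullet> cross3 (areal x) (cross3 (p x) (N x)) =
        ?n\<^sup>2 * ?a - (areal x \<bullet> cross3 (p x) (N x)) * ?b"
      by (simp add: dot_cross power2_norm_eq_inner inner_commute)
    ultimately show ?thesis
      unfolding V_r V_pN by (simp add: power2_eq_square algebra_simps)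
  qed
  have num: "((\<lambda>x. areal x \<bullet> cross3 (p x) (N x)) has_real_derivative ?a - ?u * ?Q + ?c) (at x)"
    using has_real_derivative_inner[OF areal_deriv has_vector_derivative_cross3[OF p_deriv N_deriv], of x]
    by (simp add: inner_add_right V_qN algebra_simps)
  have m_deriv: "((\<lambda>x. (norm (p x))\<^sup>2) has_real_derivative 2 * ?s) (at x)"
    using has_real_derivative_inner[OF p_deriv p_deriv, of x]
    by (simp add: power2_norm_eq_inner inner_commute)
  have den: "((\<lambda>x. norm (areal x) * (norm (p x))\<^sup>2) has_real_derivative ?b / ?n * ?m + ?n * (2 * ?s)) (at x)"
    using DERIV_mult[OF has_real_derivative_norm[OF areal_deriv] m_deriv] n
    by (simp add: algebra_simps)
  have "(flux has_real_derivative
      ((?a - ?u * ?Q + ?c) * (?n * ?m) + ?u * ?s * (?b / ?n * ?m + ?n * (2 * ?s))) / ((?n * ?m) * (?n * ?m))) (at x)"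
    using DERIV_divide[OF num den] n m
    unfolding flux_def[abs_def] V_pN by simp
  also have "((?a - ?u * ?Q + ?c) * (?n * ?m) + ?u * ?s * (?b / ?n * ?m + ?n * (2 * ?s))) / ((?n * ?m) * (?n * ?m)) =
      ((?n\<^sup>2 + ?u * ?Q + ?c) / ?m - (?m + 2 * ?u) / ?m\<^sup>2 * ?n\<^sup>2) / ?n + ?Q * ?v\<^sup>2 / ?n ^ 3"
    by (rule flux_algebra[OF n m lagrange triple])
  also have "?Q * ?v\<^sup>2 / ?n ^ 3 = dissipation x"
    by (simp add: dissipation_def power2_norm_eq_inner)
  also have "((?n\<^sup>2 + ?u * ?Q + ?c) / ?m - (?m + 2 * ?u) / ?m\<^sup>2 * ?n\<^sup>2) / ?n = length_rate x"
  proof -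
    have "angular x \<bullet> angular_rate x = (areal x \<bullet> angular_rate x) / ?m"
      by (simp add: angular_def)
    moreover have "areal x \<bullet> angular_rate x = (?n\<^sup>2 + ?u * ?Q + ?c) / ?m - (?m + 2 * ?u) / ?m\<^sup>2 * ?n\<^sup>2"
    proof -
      have m2: "norm (p x) ^ 4 = ?m\<^sup>2"
        by (simp add: power_mult[symmetric])
      show ?thesis
        unfolding angular_rate_def m2 inner_diff_right inner_scaleR_right inner_add_right V_Nq
          power2_norm_eq_inner[of "areal x", symmetric]
        by (simp add: power2_norm_eq_inner)
    qed
    ultimately show ?thesis
      using m by (simp add: length_rate_def norm_angular)
  qed
  finally show ?thesis .
qed

lemma abs_flux_le_kink: "\<bar>flux x\<bar> \<le> kink x"
proof -
  have "\<bar>areal x \<bullet> cross3 (p x) (N x)\<bar> \<le> norm (areal x) * norm (cross3 (p x) (N x))"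
    by (rule Cauchy_Schwarz_ineq2)
  also have "norm (cross3 (p x) (N x)) \<le> norm (p x) * norm (N x)"
    by (rule power2_le_imp_le) (simp_all add: norm_cross power_mult_distrib)
  finally have "\<bar>areal x \<bullet> cross3 (p x) (N x)\<bar> \<le> norm (areal x) * (norm (p x) * norm (N x))"
    by (simp add: mult_left_mono)
  then show ?thesis
    using p_nonzero[of x] 
    by (cases "areal x = 0") (simp_all add: flux_def kink_def abs_divide abs_mult power2_eq_square field_simps)
qed

lemma continuous_kink: "isCont kink x"
proof -
  have "isCont N x" "isCont p x"
    using N_deriv p_deriv has_vector_derivative_continuous by blast+
  then show ?thesis
    unfolding kink_def[abs_def] using p_nonzero[of x] by (intro continuous_intros) auto
qed

text \<open>The flux is the pairing of the direction of \<open>p \<times> q\<close> with a continuous vector field. If \<open>N z \<noteq> 0\<close>, then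
  \<open>p \<times> q\<close> has a simple zero with derivative parallel to \<open>p \<times> N\<close>, so its direction flips between
  \<open>\<plusminus> sgn (p \<times> N)\<close>. If \<open>N z = 0\<close>, the bound of the flux by the continuous function \<open>kink\<close> suffices.\<close>

lemma flux_tendsto:
  assumes z: "z \<in> radial_set"
  shows "(flux \<longlongrightarrow> kink z) (at_right z)" and "(flux \<longlongrightarrow> - kink z) (at_left z)"
proof -
  have V0: "areal z = 0"
    using z by (simp add: radial_set_def)
  have cont: "isCont N z" "isCont p z"
    using N_deriv p_deriv has_vector_derivative_continuous by blast+
  have "(flux \<longlongrightarrow> kink z) (at_right z) \<and> (flux \<longlongrightarrow> - kink z) (at_left z)"
  proof (cases "N z = 0")
    case True
    then have kink0: "kink z = 0"
      by (simp add: kink_def)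
    have "(kink \<longlongrightarrow> 0) (at z)"
      using continuous_kink[of z] unfolding isCont_def kink0 .
    then have "(flux \<longlongrightarrow> 0) (at z)"
      by (rule Lim_null_comparison[rotated]) (simp add: abs_flux_le_kink)
    then show ?thesis
      unfolding kink0 by (simp add: filterlim_at_split)
  next
    case False
    let ?X = "cross3 (p z) (N z)"
    have X: "?X \<noteq> 0"
      using norm_cross_p_N[OF z] False p_nonzero[of z] by force
    have Q: "q z \<bullet> q z > 0"
      using q_nonzero[of z] by simp
    have V': "cross3 (p z) (r z) \<noteq> 0" and sgn_V': "sgn (cross3 (p z) (r z)) = sgn ?X"
      using X Q by (simp_all add: cross_p_r[OF z] sgn_scaleR)
    define R where "R x = (1 / (norm (p x))\<^sup>2) *\<^sub>R cross3 (p x) (N x)" for x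
    have flux_eq: "flux x = sgn (areal x) \<bullet> R x" for x
      by (simp add: flux_def R_def sgn_div_norm divide_simps)
    have "isCont R z"
      unfolding R_def[abs_def]
      using cont p_nonzero[of z]
      by (intro continuous_intros bounded_bilinear.continuous[OF bounded_bilinear_cross3]) auto
    then have R: "(R \<longlongrightarrow> R z) (at z within S)" for S
      using continuous_at_imp_continuous_at_within continuous_within by blast
    have at_z: "sgn ?X \<bullet> R z = kink z"
      using X p_nonzero[of z] norm_cross_p_N[OF z]
      by (simp add: R_def kink_def sgn_div_norm power2_norm_eq_inner[symmetric] power2_eq_square field_simps)
    have "(flux \<longlongrightarrow> sgn ?X \<bullet> R z) (at_right z)" "(flux \<longlongrightarrow> (- sgn ?X) \<bullet> R z) (at_left z)"
      unfolding flux_eq[abs_def] sgn_V'[symmetric]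
      by (intro tendsto_inner R sgn_tendsto_at_simple_zero[OF areal_deriv V0 V'])+
    then show ?thesis
      by (simp add: at_z)
  qed
  then show "(flux \<longlongrightarrow> kink z) (at_right z)" and "(flux \<longlongrightarrow> - kink z) (at_left z)"
    by blast+
qed

lemma kink_isolated:
  assumes "z \<in> radial_set" "kink z \<noteq> 0"
  shows "\<not> z islimpt radial_set"
proof -
  have "N z \<noteq> 0"
    using assms(2) by (auto simp: kink_def)
  then have "cross3 (p z) (N z) \<noteq> 0"
    using norm_cross_p_N[OF assms(1)] p_nonzero[of z] by force
  then have "cross3 (p z) (r z) \<noteq> 0"
    using cross_p_r[OF assms(1)] q_nonzero[of z] by simp
  then show ?thesis
    using simple_zero_isolated[OF areal_deriv] assms(1) by (simp add: radial_set_def)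
qed

text \<open>Apart from the countably many simple zeros of \<open>p \<times> q\<close> and of \<open>N\<close>, a zero of \<open>p \<times> q\<close> has \<open>p \<times> r = 0\<close>,
  hence \<open>N = 0\<close>, hence \<open>M = 0\<close>, and then every term of the rate vanishes.\<close>

lemma countable_angular_zeros_rate_nonzero: "countable {x. angular x = 0 \<and> angular_rate x \<noteq> 0}"
proof (rule countable_subset)
  show "{x. angular x = 0 \<and> angular_rate x \<noteq> 0} \<subseteq>
      {x. areal x = 0 \<and> cross3 (p x) (r x) \<noteq> 0} \<union> {x. N x = 0 \<and> M x \<noteq> 0}"
  proof clarify
    fix x assume angular: "angular x = 0" "angular_rate x \<noteq> 0" and N: "\<not> (N x = 0 \<and> M x \<noteq> 0)"
    have V0: "areal x = 0"
      using angular(1) p_nonzero[of x] by (simp add: angular_def)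
    then have z: "x \<in> radial_set"
      by (simp add: radial_set_def)
    have "cross3 (p x) (r x) \<noteq> 0"
    proof
      assume "cross3 (p x) (r x) = 0"
      then have "cross3 (p x) (N x) = 0"
        using cross_p_r[OF z] q_nonzero[of x] by simp
      then have "N x = 0"
        using norm_cross_p_N[OF z] p_nonzero[of x] by simp
      then show False
        using N angular(2) V0 by (simp add: angular_rate_def)
    qed
    then show "areal x = 0 \<and> cross3 (p x) (r x) \<noteq> 0"
      using V0 by simp
  qed
  show "countable ({x. areal x = 0 \<and> cross3 (p x) (r x) \<noteq> 0} \<union> {x. N x = 0 \<and> M x \<noteq> 0})"
    by (intro countable_Un countable_simple_zeros areal_deriv N_deriv)
qed

end

lemma periodic_vector_derivative:
  fixes f :: "real \<Rightarrow> 'a::real_normed_vector"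
  assumes "\<And>x. f (x + P) = f x" and f': "\<And>x. (f has_vector_derivative f' x) (at x)"
  shows "f' (x + P) = f' x"
proof -
  have "((f \<circ> (\<lambda>x. x + P)) has_vector_derivative 1 *\<^sub>R f' (x + P)) (at x)"
    by (intro vector_diff_chain_at f') (auto intro!: derivative_eq_intros)
  then have "(f has_vector_derivative f' (x + P)) (at x)"
    using assms(1) by (simp add: comp_def)
  then show ?thesis
    using f' vector_derivative_unique_at by blast
qed

context radial_curve
begin

lemma continuous_p: "continuous_on S p" and continuous_q: "continuous_on S q"
  and continuous_N: "continuous_on S N"
  using p_deriv q_deriv N_deriv has_vector_derivative_at_within
  by (blast intro: continuous_on_vector_derivative)+

lemma absolutely_integrable_length_rate:
  assumes M: "continuous_on UNIV M"
  shows "length_rate absolutely_integrable_on {a..b}"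
proof -
  have p_nz: "\<forall>x. norm (p x) \<noteq> 0"
    using p_nonzero by simp
  have angular: "continuous_on UNIV angular"
    unfolding angular_def[abs_def] using p_nz
    by (intro continuous_intros continuous_p continuous_areal) auto
  have angular_rate: "continuous_on UNIV angular_rate"
    unfolding angular_rate_def[abs_def] using p_nz
    by (intro continuous_intros continuous_on_cross3 continuous_p continuous_q continuous_N continuous_areal M) auto
  have "(\<lambda>x. norm (angular_rate x)) integrable_on {a..b}"
    by (intro integrable_continuous_real continuous_on_norm continuous_on_subset[OF angular_rate]) auto
  moreover have "length_rate \<in> borel_measurable lebesgue"
  proof -
    have [measurable]: "angular \<in> borel_measurable borel" "angular_rate \<in> borel_measurable borel"
      using angular angular_rate by (auto intro: borel_measurable_continuous_onI)
    have "length_rate \<in> borel_measurable lborel"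
      unfolding length_rate_def[abs_def] by measurable
    then show ?thesis
      by (rule measurable_completion)
  qed
  then have "length_rate \<in> borel_measurable (lebesgue_on {a..b})"
    by (rule measurable_restrict_space1)
  moreover have "norm (length_rate x) \<le> norm (angular_rate x)" for x
    using Cauchy_Schwarz_ineq2[of "angular x" "angular_rate x"]
    by (cases "angular x = 0") (simp_all add: length_rate_def abs_divide divide_le_eq mult.commute)
  ultimately show ?thesis
    by (intro measurable_bounded_by_integrable_imp_absolutely_integrable) auto
qed

lemma dissipation_balance:
  assumes P: "0 < P" and p_periodic: "\<And>x. p (x + P) = p x" and M: "continuous_on UNIV M"
  shows "dissipation integrable_on {0..P}"
    and "kink summable_on radial_set \<inter> {0..<P}"
    and "integral {0..P} length_rate =
      - integral {0..P} dissipation - 2 * (\<Sum>\<^sub>\<infinity>x\<in>radial_set \<inter> {0..<P}. kink x)"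
proof -
  have q_periodic: "q (x + P) = q x" for x
    by (rule periodic_vector_derivative[OF p_periodic p_deriv])
  have r_periodic: "r (x + P) = r x" for x
    by (rule periodic_vector_derivative[OF q_periodic q_deriv])
  have N_periodic: "N (x + P) = N x" for x
    by (simp add: N_eq q_periodic r_periodic)
  have M_periodic: "M (x + P) = M x" for x
    by (rule periodic_vector_derivative[OF N_periodic N_deriv])
  have V_periodic: "areal (x + P) = areal x" for x
    by (simp add: areal_def p_periodic q_periodic)
  note periodic = p_periodic q_periodic N_periodic M_periodic V_periodic
  have periodic': "flux (x + P) = flux x" "length_rate (x + P) = length_rate x"
    "dissipation (x + P) = dissipation x" "kink (x + P) = kink x" "x + P \<in> radial_set \<longleftrightarrow> x \<in> radial_set" for x
    by (simp_all add: flux_def length_rate_def angular_def angular_rate_def dissipation_def kink_def radial_set_def periodic)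
  note balance = periodic_flux_balance[of P flux length_rate dissipation kink radial_set,
      OF P periodic' closed_radial_set absolutely_integrable_length_rate[OF M] _ _ _ flux_deriv
        flux_tendsto(2) flux_tendsto(1) _ kink_isolated]
  have *: "0 \<le> dissipation x" "0 \<le> kink x" "x \<in> radial_set \<Longrightarrow> length_rate x = 0" "x \<in> radial_set \<Longrightarrow> dissipation x = 0" for x
    by (simp_all add: dissipation_def kink_def length_rate_def angular_def radial_set_def)
  show "dissipation integrable_on {0..P}" "kink summable_on radial_set \<inter> {0..<P}"
    by (rule balance; use * in blast)+
  have "integral {0..P} dissipation =
      - integral {0..P} length_rate - 2 * (\<Sum>\<^sub>\<infinity>x\<in>radial_set \<inter> {0..<P}. kink x)"
    by (rule balance; use * in blast)
  then show "integral {0..P} length_rate =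
      - integral {0..P} dissipation - 2 * (\<Sum>\<^sub>\<infinity>x\<in>radial_set \<inter> {0..<P}. kink x)"
    by simp
qed

end

section \<open>Curvature, radial points and the angle \<psi>\<close>

lemma sin_psi: "sin (psi c x) = (c x \<bullet> tangent c x) / (norm (c x) * norm (tangent c x))"
  and norm_mult_cos_psi: "norm (c x) * norm (tangent c x) * cos (psi c x) = norm (cross3 (c x) (tangent c x))"
proof -
  let ?k = "norm (c x) * norm (tangent c x)"
  define t where "t = (c x \<bullet> tangent c x) / ?k"
  have t: "\<bar>t\<bar> \<le> 1"
    using Cauchy_Schwarz_ineq2[of "c x" "tangent c x"]
    by (cases "?k = 0") (auto simp: t_def abs_divide divide_le_eq_1)
  then have t1: "-1 \<le> t" "t \<le> 1"
    by (auto simp: abs_le_iff)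
  have psi: "psi c x = arcsin t"
    by (simp add: psi_def t_def)
  show "sin (psi c x) = (c x \<bullet> tangent c x) / ?k"
    using t1 by (simp add: psi flip: t_def)
  have cos: "cos (psi c x) = sqrt (1 - t\<^sup>2)"
    using t1 by (simp add: psi cos_arcsin)
  have t2: "t\<^sup>2 \<le> 1"
    using t by (simp add: abs_square_le_1)
  show "?k * cos (psi c x) = norm (cross3 (c x) (tangent c x))"
  proof (cases "?k = 0")
    case True
    then show ?thesis
      by auto
  next
    case False
    have "(?k * cos (psi c x))\<^sup>2 = ?k\<^sup>2 * (1 - t\<^sup>2)"
      using t2 by (simp add: cos power_mult_distrib)
    also have "\<dots> = ?k\<^sup>2 - (c x \<bullet> tangent c x)\<^sup>2"
      using False by (simp add: t_def power_divide field_simps)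
    also have "\<dots> = (norm (cross3 (c x) (tangent c x)))\<^sup>2"
      by (simp add: norm_cross power_mult_distrib)
    finally show ?thesis
      by (rule power2_eq_imp_eq) (use t2 in \<open>simp_all add: cos\<close>)
  qed
qed

lemma radial_iff_cos_psi_zero:
  "psi c x = pi / 2 \<or> psi c x = - pi / 2 \<longleftrightarrow> cos (psi c x) = 0"
proof
  assume "cos (psi c x) = 0"
  moreover have "- (pi / 2) \<le> psi c x" "psi c x \<le> pi / 2"
  proof -
    have "- 1 \<le> sin (psi c x)" "sin (psi c x) \<le> 1"
      by simp_all
    note ratio_bounds = this[unfolded sin_psi]
    show "- (pi / 2) \<le> psi c x"
      unfolding psi_def by (rule arcsin_lbound[OF ratio_bounds])
    show "psi c x \<le> pi / 2"
      unfolding psi_def by (rule arcsin_ubound[OF ratio_bounds])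
  qed
  ultimately show "psi c x = pi / 2 \<or> psi c x = - pi / 2"
    using cos_gt_zero_pi[of "psi c x"] by fastforce
next
  assume "psi c x = pi / 2 \<or> psi c x = - pi / 2"
  then show "cos (psi c x) = 0"
    by (elim disjE) (simp_all only: cos_pi_half cos_minus minus_divide_left[symmetric])
qed

context radial_curve
begin

lemma tangent_eq: "tangent p = q"
  by (simp add: fun_eq_iff tangent_def vector_derivative_at[OF p_deriv])

lemma accel_eq: "accel p = r"
  by (simp add: fun_eq_iff accel_def tangent_eq vector_derivative_at[OF q_deriv])

lemma curvature_eq: "curvature p x = norm (N x)"
proof -
  have "norm (cross3 (q x) (cross3 (r x) (q x))) = norm (q x) * norm (cross3 (r x) (q x))"
    by (rule power2_eq_imp_eq) (simp_all add: norm_cross dot_cross_self power_mult_distrib)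
  then show ?thesis
    using q_nonzero[of x]
    by (simp add: curvature_def tangent_eq accel_eq N_eq power3_eq_cube power4_eq_xxxx)
qed

lemma kink_eq: "curvature p x / norm (p x) = kink x"
  by (simp add: kink_def curvature_eq)

lemma cos_psi_zero_iff: "cos (psi p x) = 0 \<longleftrightarrow> x \<in> radial_set"
proof -
  have norm_V: "norm (areal x) = norm (p x) * norm (q x) * cos (psi p x)"
    using norm_mult_cos_psi[of p x] unfolding areal_def tangent_eq by (rule sym)
  have "x \<in> radial_set \<longleftrightarrow> norm (areal x) = 0"
    by (simp add: radial_set_def)
  also have "\<dots> \<longleftrightarrow> cos (psi p x) = 0"
    unfolding norm_V using p_nonzero[of x] q_nonzero[of x] by simp
  finally show ?thesis
    by (rule sym)
qed

lemma radial_points_eq: "radial_points p = radial_set \<inter> {0..<2 * pi}"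
proof (rule set_eqI)
  show "x \<in> radial_points p \<longleftrightarrow> x \<in> radial_set \<inter> {0..<2 * pi}" for x
    unfolding radial_points_def mem_Collect_eq radial_iff_cos_psi_zero cos_psi_zero_iff Int_iff
    by (rule conj_commute)
qed

lemma curvature_normal: "curvature p x *\<^sub>R unit_normal p x = N x"
proof (cases "cross3 (r x) (q x) = 0")
  case True
  then show ?thesis
    by (simp add: curvature_def tangent_eq accel_eq N_eq)
next
  case False
  let ?B = "cross3 (r x) (q x)"
  have "curvature p x * (1 / (norm (q x) * norm ?B)) = 1 / norm (q x) ^ 4"
    using False by (simp add: curvature_def tangent_eq accel_eq eval_nat_numeral)
  then show ?thesis
    by (simp only: unit_normal_def tangent_eq accel_eq scaleR_scaleR N_eq)
qed

text \<open>Here \<open>\<kappa>\<^sup>2 |Proj|\<^sup>2 = (p \<bullet> (N \<times> q))\<^sup>2 / |q|\<^sup>2\<close>, because \<open>\<nu> \<times> q\<close> has length \<open>|q|\<close> wherever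
  \<open>\<kappa> \<noteq> 0\<close>. At radial points both sides are \<open>0\<close> by division by zero.\<close>

lemma curvature_density_eq: "curvature_density p x = dissipation x"
proof -
  let ?\<kappa> = "curvature p x" and ?w = "cross3 (unit_normal p x) (q x)" and ?k = "norm (p x) * norm (q x)"
  have proj: "?\<kappa>\<^sup>2 * (norm (proj_line ?w (p x)))\<^sup>2 = (areal x \<bullet> N x)\<^sup>2 / (norm (q x))\<^sup>2"
  proof (cases "N x = 0")
    case True
    then show ?thesis
      by (simp add: curvature_eq)
  next
    case False
    then have \<kappa>: "?\<kappa> \<noteq> 0"
      by (simp add: curvature_eq)
    have w: "?\<kappa> *\<^sub>R ?w = cross3 (N x) (q x)"
      by (simp flip: curvature_normal cross_mult_left)
    have "?\<kappa>\<^sup>2 * (?w \<bullet> ?w) = cross3 (N x) (q x) \<bullet> cross3 (N x) (q x)"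
      by (simp flip: w add: power2_eq_square)
    also have "\<dots> = ?\<kappa>\<^sup>2 * (norm (q x))\<^sup>2"
      using q_N[of x] by (simp add: dot_cross curvature_eq power2_norm_eq_inner inner_commute)
    finally have ww: "?w \<bullet> ?w = (norm (q x))\<^sup>2"
      using \<kappa> by simp
    have "?\<kappa> * (p x \<bullet> ?w) = p x \<bullet> cross3 (N x) (q x)"
      by (simp flip: w)
    also have "\<dots> = - (areal x \<bullet> N x)"
      unfolding areal_def cross_triple[of "p x" "q x" "N x"] cross_skew[of "N x" "q x"]
      by (simp add: inner_commute)
    finally have pw: "(?\<kappa> * (p x \<bullet> ?w))\<^sup>2 = (areal x \<bullet> N x)\<^sup>2"
      by simp
    have nw: "(norm ?w)\<^sup>2 = (norm (q x))\<^sup>2"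
      by (simp only: power2_norm_eq_inner[of ?w] ww)
    have "(norm (proj_line ?w (p x)))\<^sup>2 = ((p x \<bullet> ?w) / (norm (q x))\<^sup>2)\<^sup>2 * (norm ?w)\<^sup>2"
      by (simp only: proj_line_def ww norm_scaleR power_mult_distrib real_norm_def power2_abs)
    also have "\<dots> = (p x \<bullet> ?w)\<^sup>2 / (norm (q x))\<^sup>2"
      unfolding nw using q_nonzero[of x] by (simp add: power_divide power2_eq_square)
    finally have "(norm (proj_line ?w (p x)))\<^sup>2 = (p x \<bullet> ?w)\<^sup>2 / (norm (q x))\<^sup>2" .
    then show ?thesis
      using pw by (simp add: power_mult_distrib)
  qed
  have nV: "norm (areal x) = ?k * cos (psi p x)"
    using norm_mult_cos_psi[of p x] by (simp add: areal_def tangent_eq)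
  have "curvature_density p x =
      norm (q x) / (norm (p x) ^ 3 * cos (psi p x) ^ 3) * (?\<kappa>\<^sup>2 * (norm (proj_line ?w (p x)))\<^sup>2)"
    by (simp add: curvature_density_def tangent_eq)
  also have "\<dots> = dissipation x"
  proof -
    have "(?k * cos (psi p x)) ^ 3 = (norm (q x))\<^sup>2 * (norm (q x) * (norm (p x) ^ 3 * cos (psi p x) ^ 3))"
      by (simp add: power_mult_distrib power2_eq_square power3_eq_cube)
    then have "dissipation x = (areal x \<bullet> N x)\<^sup>2 / (norm (q x) * (norm (p x) ^ 3 * cos (psi p x) ^ 3))"
      unfolding dissipation_def nV using q_nonzero[of x] by simp
    then show ?thesis
      unfolding proj using q_nonzero[of x] by (simp add: power2_eq_square)
  qed
  finally show ?thesis .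
qed

end

text \<open>Substitution of \<open>y = norm (p x)\<close>, which has equal values at both ends.\<close>

lemma radial_integral_zero:
  fixes p q :: "real \<Rightarrow> 'a::real_inner" and a :: "real \<Rightarrow> real"
  assumes P: "0 \<le> P" "p P = p 0"
    and p: "\<And>x. (p has_vector_derivative q x) (at x)" "\<And>x. p x \<noteq> 0"
    and a: "continuous_on {0..} a"
  shows "((\<lambda>x. a (norm (p x)) * ((p x \<bullet> q x) / norm (p x))) has_integral 0) {0..P}"
proof -
  have deriv: "((\<lambda>x. norm (p x)) has_real_derivative (p x \<bullet> q x) / norm (p x)) (at x)" for x
    by (rule has_real_derivative_norm[OF p])
  then have "continuous_on {0..P} (\<lambda>x. norm (p x))"
    by (intro DERIV_continuous_on) (blast intro: has_field_derivative_at_within)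
  then have "compact ((\<lambda>x. norm (p x)) ` {0..P})"
    by (intro compact_continuous_image) auto
  then obtain R where R: "\<And>y. y \<in> (\<lambda>x. norm (p x)) ` {0..P} \<Longrightarrow> norm y \<le> R"
    using compact_imp_bounded bounded_iff by metis
  have "((\<lambda>x. ((p x \<bullet> q x) / norm (p x)) *\<^sub>R a (norm (p x))) has_integral
      integral {norm (p 0)..norm (p P)} a) {0..P}"
  proof (rule has_integral_substitution)
    show "(\<lambda>x. norm (p x)) ` {0..P} \<subseteq> {0..R}"
      using R by fastforce
    show "continuous_on {0..R} a"
      using a by (rule continuous_on_subset) auto
    show "((\<lambda>x. norm (p x)) has_real_derivative (p x \<bullet> q x) / norm (p x)) (at x within {0..P})" for x
      using deriv by (rule has_field_derivative_at_within)
  qed (use P in auto)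
  then show ?thesis
    by (simp add: P mult.commute)
qed

section \<open>Partial derivatives of a smooth family of curves\<close>

lemma smooth_on_imp_continuous_on: "smooth_on S f \<Longrightarrow> continuous_on S f"
  unfolding smooth_on_def by (metis higher_differentiable_on.simps(1))

lemma smooth_on_imp_differentiable: "smooth_on S f \<Longrightarrow> z \<in> S \<Longrightarrow> f differentiable (at z)"
  unfolding smooth_on_def by (metis higher_differentiable_on.simps(2))

lemma smooth_on_frechet_derivative:
  "smooth_on S f \<Longrightarrow> smooth_on S (\<lambda>z. frechet_derivative f (at z) v)"
  unfolding smooth_on_def by (metis higher_differentiable_on.simps(2))

lemma has_vector_derivative_partials:
  fixes f :: "real \<times> real \<Rightarrow> 'a::real_normed_vector"
  assumes "f differentiable (at (s, x))"
  shows "((\<lambda>s. f (s, x)) has_vector_derivative frechet_derivative f (at (s, x)) (1, 0)) (at s)"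
    and "((\<lambda>x. f (s, x)) has_vector_derivative frechet_derivative f (at (s, x)) (0, 1)) (at x)"
proof -
  let ?f' = "frechet_derivative f (at (s, x))"
  have f': "(f has_derivative ?f') (at (s, x))"
    using assms frechet_derivative_works by blast
  then have lin: "linear ?f'"
    by (rule has_derivative_linear)
  have "((f \<circ> (\<lambda>s. (s, x))) has_derivative (?f' \<circ> (\<lambda>h. (h, 0)))) (at s)"
    by (rule diff_chain_at) (auto intro!: derivative_eq_intros f')
  moreover have "?f' \<circ> (\<lambda>h. (h, 0)) = (\<lambda>h. h *\<^sub>R ?f' (1, 0))"
    by (simp add: fun_eq_iff flip: linear_cmul[OF lin])
  ultimately show "((\<lambda>s. f (s, x)) has_vector_derivative ?f' (1, 0)) (at s)"
    by (simp add: has_vector_derivative_def comp_def)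
  have "((f \<circ> (\<lambda>x. (s, x))) has_derivative (?f' \<circ> (\<lambda>h. (0, h)))) (at x)"
    by (rule diff_chain_at) (auto intro!: derivative_eq_intros f')
  moreover have "?f' \<circ> (\<lambda>h. (0, h)) = (\<lambda>h. h *\<^sub>R ?f' (0, 1))"
    by (simp add: fun_eq_iff flip: linear_cmul[OF lin])
  ultimately show "((\<lambda>x. f (s, x)) has_vector_derivative ?f' (0, 1)) (at x)"
    by (simp add: has_vector_derivative_def comp_def)
qed

lemma smooth_surface_partials:
  fixes f :: "real \<Rightarrow> real \<Rightarrow> 'a::real_normed_vector"
  assumes f: "smooth_on (J \<times> UNIV) (\<lambda>(s, x). f s x)"
  obtains fs fx where
    "smooth_on (J \<times> UNIV) (\<lambda>(s, x). fs s x)" "smooth_on (J \<times> UNIV) (\<lambda>(s, x). fx s x)"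
    "\<And>s x. s \<in> J \<Longrightarrow> ((\<lambda>s. f s x) has_vector_derivative fs s x) (at s)"
    "\<And>s x. s \<in> J \<Longrightarrow> (f s has_vector_derivative fx s x) (at x)"
proof
  let ?D = "\<lambda>v s x. frechet_derivative (\<lambda>(s, x). f s x) (at (s, x)) v"
  have "(\<lambda>z. frechet_derivative (\<lambda>(s, x). f s x) (at z) v) = (\<lambda>(s, x). ?D v s x)" for v
    by auto
  then show "smooth_on (J \<times> UNIV) (\<lambda>(s, x). ?D (1, 0) s x)" "smooth_on (J \<times> UNIV) (\<lambda>(s, x). ?D (0, 1) s x)"
    using smooth_on_frechet_derivative[OF f] by metis+
  have "(\<lambda>(s, x). f s x) differentiable (at (s, x))" if "s \<in> J" for s x
    by (rule smooth_on_imp_differentiable[OF f]) (simp add: that)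
  note partials = has_vector_derivative_partials[OF this]
  show "((\<lambda>s. f s x) has_vector_derivative ?D (1, 0) s x) (at s)" "(f s has_vector_derivative ?D (0, 1) s x) (at x)"
    if "s \<in> J" for s x
    using partials[OF that, of x] by simp_all
qed

lemma continuous_on_slice:
  fixes g :: "real \<Rightarrow> real \<Rightarrow> 'a::topological_space"
  assumes "s \<in> U" "continuous_on (U \<times> UNIV) (\<lambda>(s, x). g s x)"
  shows "continuous_on S (g s)"
proof -
  have "continuous_on S ((\<lambda>(s, x). g s x) \<circ> (\<lambda>x. (s, x)))"
    by (intro continuous_on_compose continuous_intros continuous_on_subset[OF assms(2)])
      (use assms(1) in auto)
  then show ?thesis
    by (simp add: comp_def)
qed

text \<open>Differentiation under the integral sign in \<open>f s y = f s a + integral {a..y} (fx s)\<close>, followed by the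
  fundamental theorem of calculus in \<open>y\<close>. For the flow it yields the derivative of the curvature vector.\<close>

lemma mixed_partials_commute:
  fixes f :: "real \<Rightarrow> real \<Rightarrow> 'a::banach"
  assumes U: "convex U" "open U" "\<tau> \<in> U"
    and fs: "\<And>x. ((\<lambda>s. f s x) has_vector_derivative fs x) (at \<tau>)"
    and fx: "\<And>s x. s \<in> U \<Longrightarrow> (f s has_vector_derivative fx s x) (at x)"
    and fxs: "\<And>s x. s \<in> U \<Longrightarrow> ((\<lambda>s. fx s x) has_vector_derivative fxs s x) (at s)"
    and cont_fx: "continuous_on (U \<times> UNIV) (\<lambda>(s, x). fx s x)"
    and cont_fxs: "continuous_on (U \<times> UNIV) (\<lambda>(s, x). fxs s x)"
  shows "(fs has_vector_derivative fxs \<tau> x) (at x)"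
proof -
  define a b where "a = x - 1" and "b = x + 1"
  have fs_eq: "fs y = fs a + integral {a..y} (fxs \<tau>)" if y: "a \<le> y" for y
  proof -
    have ftc: "f s y = f s a + integral {a..y} (fx s)" if "s \<in> U" for s
      using fundamental_theorem_of_calculus[OF y, of "f s" "fx s"] fx[OF that]
      by (simp add: has_vector_derivative_at_within integral_unique)
    have "((\<lambda>s. integral (cbox a y) (fx s)) has_vector_derivative integral (cbox a y) (fxs \<tau>)) (at \<tau> within U)"
    proof (rule leibniz_rule_vector_derivative)
      show "continuous_on (U \<times> cbox a y) (\<lambda>(s, x). fxs s x)"
        by (rule continuous_on_subset[OF cont_fxs]) auto
      show "fx s integrable_on cbox a y" if "s \<in> U" for s
        using continuous_on_slice[OF that cont_fx] by (rule integrable_continuous)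
      show "((\<lambda>s. fx s x) has_vector_derivative fxs s x) (at s within U)" if "s \<in> U" for s x
        using fxs[OF that] by (rule has_vector_derivative_at_within)
    qed (rule U)+
    then have "((\<lambda>s. integral {a..y} (fx s)) has_vector_derivative integral {a..y} (fxs \<tau>)) (at \<tau>)"
      by (simp add: at_within_open[OF U(3,2)])
    then have "((\<lambda>s. f s a + integral {a..y} (fx s)) has_vector_derivative fs a + integral {a..y} (fxs \<tau>)) (at \<tau>)"
      by (rule has_vector_derivative_add[OF fs])
    then have "((\<lambda>s. f s y) has_vector_derivative fs a + integral {a..y} (fxs \<tau>)) (at \<tau>)"
      by (rule has_vector_derivative_transform_within_open[OF _ U(2,3)]) (simp add: ftc)
    then show ?thesis
      using fs vector_derivative_unique_at by blast
  qed
  have "((\<lambda>y. integral {a..y} (fxs \<tau>)) has_vector_derivative fxs \<tau> x) (at x within {a..b})"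
    by (rule integral_has_vector_derivative[OF continuous_on_slice[OF U(3) cont_fxs]]) (simp add: a_def b_def)
  then have "((\<lambda>y. integral {a..y} (fxs \<tau>)) has_vector_derivative fxs \<tau> x) (at x)"
    by (simp add: a_def b_def at_within_Icc_at)
  then have "((\<lambda>y. fs a + integral {a..y} (fxs \<tau>)) has_vector_derivative 0 + fxs \<tau> x) (at x)"
    by (intro has_vector_derivative_add has_vector_derivative_const)
  then have "((\<lambda>y. fs a + integral {a..y} (fxs \<tau>)) has_vector_derivative fxs \<tau> x) (at x)"
    by simp
  then show ?thesis
  proof (rule has_vector_derivative_transform_within_open[where S = "{a<..}"])
    show "fs a + integral {a..y} (fxs \<tau>) = fs y" if "y \<in> {a<..}" for y
      using fs_eq[of y] that by simp
  qed (simp_all add: a_def)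
qed

lemma has_vector_derivative_direction_cross:
  assumes p: "(p has_vector_derivative p') (at s)" and q: "(q has_vector_derivative q') (at s)"
    and nz: "p s \<noteq> 0"
  shows "((\<lambda>s. (1 / (norm (p s))\<^sup>2) *\<^sub>R cross3 (p s) (q s)) has_vector_derivative
    (1 / (norm (p s))\<^sup>2) *\<^sub>R (cross3 (p s) q' + cross3 p' (q s)) -
    (2 * (p s \<bullet> p') / norm (p s) ^ 4) *\<^sub>R cross3 (p s) (q s)) (at s)"
proof -
  have "((\<lambda>s. p s \<bullet> p s) has_real_derivative 2 * (p s \<bullet> p')) (at s)"
    using has_real_derivative_inner[OF p p] by (simp add: inner_commute)
  then have "((\<lambda>s. inverse (p s \<bullet> p s)) has_real_derivative
      - (2 * (p s \<bullet> p') * inverse ((p s \<bullet> p s) ^ Suc (Suc 0)))) (at s)"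
    by (rule DERIV_inverse_fun) (use nz in simp)
  moreover have "norm (p s) ^ 4 = (p s \<bullet> p s) ^ Suc (Suc 0)"
    by (simp add: power2_norm_eq_inner[symmetric] eval_nat_numeral)
  ultimately have "((\<lambda>s. 1 / (norm (p s))\<^sup>2) has_real_derivative
      - (2 * (p s \<bullet> p') / norm (p s) ^ 4)) (at s)"
    by (simp add: power2_norm_eq_inner divide_inverse)
  from has_vector_derivative_scaleR[OF this has_vector_derivative_cross3[OF p q]]
  show ?thesis
    by simp
qed

section \<open>Monotonicity of the length of the radial projection\<close>

theorem theorem1:
  fixes \<gamma> :: "real \<Rightarrow> real \<Rightarrow> real^3" and J :: "real set" and \<tau> :: real
  assumes "rescaled_csf J \<gamma>"
    and "\<tau> \<in> J"
    and "\<And>x. \<gamma> \<tau> x \<noteq> 0"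
  shows "curvature_density (\<gamma> \<tau>) integrable_on {0..2 * pi} \<and>
    (\<lambda>x. curvature (\<gamma> \<tau>) x / norm (\<gamma> \<tau> x)) summable_on radial_points (\<gamma> \<tau>) \<and>
    ((\<lambda>s. integral {0..2 * pi}
        (\<lambda>x. norm (tangent (\<gamma> s) x) / norm (\<gamma> s x) * cos (psi (\<gamma> s) x)))
      has_real_derivative
        - integral {0..2 * pi} (curvature_density (\<gamma> \<tau>))
        - 2 * (\<Sum>\<^sub>\<infinity>x\<in>radial_points (\<gamma> \<tau>). curvature (\<gamma> \<tau>) x / norm (\<gamma> \<tau> x)))
      (at \<tau>) \<and>
    (\<forall>a :: real \<Rightarrow> real. continuous_on {0..} a \<longrightarrow>
      ((\<lambda>x. a (norm (\<gamma> \<tau> x)) * norm (tangent (\<gamma> \<tau>) x) * sin (psi (\<gamma> \<tau>) x))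
        has_integral 0) {0..2 * pi})"
proof -
  have "open J" and "is_interval J" and smooth: "smooth_on (J \<times> UNIV) (\<lambda>(s, x). \<gamma> s x)"
    and regular: "\<And>s. s \<in> J \<Longrightarrow> closed_regular_curve (\<gamma> s)"
    and flow: "\<And>s x. s \<in> J \<Longrightarrow> ((\<lambda>s. \<gamma> s x) has_vector_derivative
        ((1 / 2) *\<^sub>R \<gamma> s x + (1 / norm (tangent (\<gamma> s) x) ^ 4) *\<^sub>R
           cross3 (tangent (\<gamma> s) x) (cross3 (accel (\<gamma> s) x) (tangent (\<gamma> s) x)))) (at s)"
    using assms(1) unfolding rescaled_csf_def by blast+
  have "convex J"
    using \<open>is_interval J\<close> by (rule is_interval_convex)
  obtain \<gamma>s \<gamma>x where smooth_s: "smooth_on (J \<times> UNIV) (\<lambda>(s, x). \<gamma>s s x)"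
    and smooth_x: "smooth_on (J \<times> UNIV) (\<lambda>(s, x). \<gamma>x s x)"
    and \<gamma>s: "\<And>s x. s \<in> J \<Longrightarrow> ((\<lambda>s. \<gamma> s x) has_vector_derivative \<gamma>s s x) (at s)"
    and \<gamma>x: "\<And>s x. s \<in> J \<Longrightarrow> (\<gamma> s has_vector_derivative \<gamma>x s x) (at x)"
    by (rule smooth_surface_partials[OF smooth]) (rule that)
  obtain \<gamma>xs \<gamma>xx where smooth_xs: "smooth_on (J \<times> UNIV) (\<lambda>(s, x). \<gamma>xs s x)"
    and "smooth_on (J \<times> UNIV) (\<lambda>(s, x). \<gamma>xx s x)"
    and \<gamma>xs: "\<And>s x. s \<in> J \<Longrightarrow> ((\<lambda>s. \<gamma>x s x) has_vector_derivative \<gamma>xs s x) (at s)"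
    and \<gamma>xx: "\<And>s x. s \<in> J \<Longrightarrow> (\<gamma>x s has_vector_derivative \<gamma>xx s x) (at x)"
    by (rule smooth_surface_partials[OF smooth_x]) (rule that)
  have tangent: "tangent (\<gamma> s) = \<gamma>x s" if "s \<in> J" for s
    using vector_derivative_at[OF \<gamma>x[OF that]] by (simp add: fun_eq_iff tangent_def)
  have accel: "accel (\<gamma> s) = \<gamma>xx s" if "s \<in> J" for s
    using vector_derivative_at[OF \<gamma>xx[OF that]] by (simp add: fun_eq_iff accel_def tangent[OF that])
  have \<gamma>x_nonzero: "\<gamma>x s x \<noteq> 0" if "s \<in> J" for s x
    using regular[OF that] by (simp add: closed_regular_curve_def tangent[OF that])
  \<comment> \<open>The velocity of the flow without its scaling part is the curvature vector.\<close>
  define N M where "N x = \<gamma>s \<tau> x - (1 / 2) *\<^sub>R \<gamma> \<tau> x" and "M x = \<gamma>xs \<tau> x - (1 / 2) *\<^sub>R \<gamma>x \<tau> x" for x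
  have \<gamma>sx: "(\<gamma>s \<tau> has_vector_derivative \<gamma>xs \<tau> x) (at x)" for x
    by (rule mixed_partials_commute[OF \<open>convex J\<close> \<open>open J\<close> \<open>\<tau> \<in> J\<close> \<gamma>s[OF \<open>\<tau> \<in> J\<close>] \<gamma>x \<gamma>xs
          smooth_on_imp_continuous_on[OF smooth_x] smooth_on_imp_continuous_on[OF smooth_xs]])
  interpret radial_curve "\<gamma> \<tau>" "\<gamma>x \<tau>" "\<gamma>xx \<tau>" N M
  proof
    show "(N has_vector_derivative M x) (at x)" for x
      unfolding N_def[abs_def] M_def
      by (intro has_vector_derivative_diff \<gamma>sx bounded_linear.has_vector_derivative[OF bounded_linear_scaleR_right] \<gamma>x \<open>\<tau> \<in> J\<close>)
    show "N x = (1 / norm (\<gamma>x \<tau> x) ^ 4) *\<^sub>R cross3 (\<gamma>x \<tau> x) (cross3 (\<gamma>xx \<tau> x) (\<gamma>x \<tau> x))" for x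
      using vector_derivative_unique_at[OF \<gamma>s[OF \<open>\<tau> \<in> J\<close>] flow[OF \<open>\<tau> \<in> J\<close>], of x]
      by (simp add: N_def tangent accel \<open>\<tau> \<in> J\<close>)
  qed (simp_all add: \<gamma>x \<gamma>xx \<gamma>x_nonzero assms(2,3))
  have periodic: "\<gamma> \<tau> (x + 2 * pi) = \<gamma> \<tau> x" for x
    using regular[OF \<open>\<tau> \<in> J\<close>] by (simp add: closed_regular_curve_def)
  note slice = continuous_on_slice[OF _ smooth_on_imp_continuous_on]
  have contM: "continuous_on UNIV M"
    unfolding M_def[abs_def] using \<open>\<tau> \<in> J\<close> smooth_x smooth_xs by (intro continuous_intros slice)
  have "0 < 2 * pi"
    by simp
  note balance = dissipation_balance[OF this periodic contM]
  have density: "curvature_density (\<gamma> \<tau>) = dissipation"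
    by (simp add: fun_eq_iff curvature_density_eq)
  obtain \<epsilon> where \<epsilon>: "0 < \<epsilon>" and near: "\<And>s x. \<bar>s - \<tau>\<bar> \<le> \<epsilon> \<Longrightarrow> x \<in> {0..2 * pi} \<Longrightarrow> s \<in> J \<and> \<gamma> s x \<noteq> 0"
  proof -
    let ?O = "(J \<times> UNIV) \<inter> (\<lambda>(s, x). \<gamma> s x) -` (- {0})"
    have "open ?O"
      using smooth_on_imp_continuous_on[OF smooth] \<open>open J\<close>
      by (intro continuous_open_preimage open_Times) auto
    moreover have "{\<tau>} \<times> {0..2 * pi} \<subseteq> ?O"
      using \<open>\<tau> \<in> J\<close> assms(3) by auto
    ultimately obtain X where X: "\<tau> \<in> X" "open X" "X \<times> {0..2 * pi} \<subseteq> ?O"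
      using Elementary_Topology.tube_lemma[of "{0..2 * pi}" ?O \<tau>] by auto
    then obtain \<epsilon> where \<epsilon>: "0 < \<epsilon>" "cball \<tau> \<epsilon> \<subseteq> X"
      using open_contains_cball by blast
    have "s \<in> J \<and> \<gamma> s x \<noteq> 0" if "\<bar>s - \<tau>\<bar> \<le> \<epsilon>" "x \<in> {0..2 * pi}" for s x
    proof -
      have "s \<in> X"
        using that(1) \<epsilon>(2) by (auto simp: dist_real_def abs_minus_commute)
      then have "(s, x) \<in> ?O"
        using that(2) X(3) by blast
      then show ?thesis
        by auto
    qed
    then show ?thesis
      using that \<epsilon>(1) by blast
  qed
  have near_J: "s \<in> J" if "\<bar>s - \<tau>\<bar> \<le> \<epsilon>" for s
    using near[OF that, of 0] by simp
  \<comment> \<open>The vector \<open>angular\<close> of each curve of the family near time \<open>\<tau>\<close>, and its time derivative.\<close>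
  define A where "A s x = (1 / (norm (\<gamma> s x))\<^sup>2) *\<^sub>R cross3 (\<gamma> s x) (\<gamma>x s x)" for s x
  define A' where "A' s x = (1 / (norm (\<gamma> s x))\<^sup>2) *\<^sub>R (cross3 (\<gamma> s x) (\<gamma>xs s x) + cross3 (\<gamma>s s x) (\<gamma>x s x)) -
      (2 * (\<gamma> s x \<bullet> \<gamma>s s x) / norm (\<gamma> s x) ^ 4) *\<^sub>R cross3 (\<gamma> s x) (\<gamma>x s x)" for s x
  have A_W: "A \<tau> = angular"
    by (simp add: fun_eq_iff A_def angular_def areal_def)
  have A'_W_rate: "A' \<tau> = angular_rate"
  proof
    fix x
    have "\<gamma>s \<tau> x = N x + (1 / 2) *\<^sub>R \<gamma> \<tau> x" "\<gamma>xs \<tau> x = M x + (1 / 2) *\<^sub>R \<gamma>x \<tau> x"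
      by (simp_all add: N_def M_def)
    then have "cross3 (\<gamma> \<tau> x) (\<gamma>xs \<tau> x) + cross3 (\<gamma>s \<tau> x) (\<gamma>x \<tau> x) =
        areal x + cross3 (N x) (\<gamma>x \<tau> x) + cross3 (\<gamma> \<tau> x) (M x)"
      and "2 * (\<gamma> \<tau> x \<bullet> \<gamma>s \<tau> x) = (norm (\<gamma> \<tau> x))\<^sup>2 + 2 * (\<gamma> \<tau> x \<bullet> N x)"
      by (simp_all add: cross_add_left cross_add_right cross_mult_left cross_mult_right areal_def
          inner_add_right power2_norm_eq_inner flip: scaleR_add_left)
    then show "A' \<tau> x = angular_rate x"
      by (simp only: A'_def angular_rate_def areal_def)
  qed
  have length_deriv: "((\<lambda>s. integral {0..2 * pi} (\<lambda>x. norm (A s x))) has_real_derivative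
      integral {0..2 * pi} (\<lambda>x. (A \<tau> x \<bullet> A' \<tau> x) / norm (A \<tau> x))) (at \<tau>)"
  proof (rule has_real_derivative_integral_norm[OF \<epsilon>])
    let ?K = "{\<tau> - \<epsilon>..\<tau> + \<epsilon>} \<times> {0..2 * pi}"
      show "((\<lambda>s. A s x) has_vector_derivative A' s x) (at s)"
      if "\<bar>s - \<tau>\<bar> \<le> \<epsilon>" "x \<in> {0..2 * pi}" for s x
      unfolding A_def[abs_def] A'_def
      by (rule has_vector_derivative_direction_cross) (use near[OF that] \<gamma>s \<gamma>xs in auto)
    show "continuous_on {0..2 * pi} (A s)" if "\<bar>s - \<tau>\<bar> \<le> \<epsilon>" for s
      unfolding A_def[abs_def] using near[OF that] near_J[OF that] smooth smooth_x
      by (intro continuous_intros continuous_on_cross3 slice) auto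
    have K: "?K \<subseteq> J \<times> UNIV"
      using near_J by (auto simp: abs_le_iff)
    have K_nonzero: "\<forall>z\<in>?K. (case z of (s, x) \<Rightarrow> \<gamma> s x) \<noteq> 0"
      using near by (auto simp: abs_le_iff)
    have cont: "continuous_on ?K (\<lambda>(s, x). g s x)" if "smooth_on (J \<times> UNIV) (\<lambda>(s, x). g s x)"
      for g :: "real \<Rightarrow> real \<Rightarrow> real^3"
      using smooth_on_imp_continuous_on[OF that] K by (rule continuous_on_subset)
    show "continuous_on ?K (\<lambda>(s, x). A' s x)"
      unfolding A'_def case_prod_unfold
      using cont[OF smooth] cont[OF smooth_s] cont[OF smooth_x] cont[OF smooth_xs] K_nonzero
      unfolding case_prod_unfold
      by (intro continuous_intros continuous_on_cross3) auto
    show "negligible {x \<in> {0..2 * pi}. A \<tau> x = 0 \<and> A' \<tau> x \<noteq> 0}"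
      unfolding A_W A'_W_rate
      unfolding negligible_iff_null_sets
      by (intro null_sets_completionI countable_imp_null_set_lborel
          countable_subset[OF _ countable_angular_zeros_rate_nonzero]) auto
  qed
  have integrand: "norm (tangent (\<gamma> s) x) / norm (\<gamma> s x) * cos (psi (\<gamma> s) x) = norm (A s x)"
    if "s \<in> J" "\<gamma> s x \<noteq> 0" for s x
    using norm_mult_cos_psi[of "\<gamma> s" x] that
    by (simp add: A_def tangent power2_eq_square field_simps)
  have "((\<lambda>s. integral {0..2 * pi} (\<lambda>x. norm (tangent (\<gamma> s) x) / norm (\<gamma> s x) * cos (psi (\<gamma> s) x)))
      has_real_derivative integral {0..2 * pi} length_rate) (at \<tau>)"
  proof (rule has_field_derivative_transform_within[OF _ \<epsilon>])
    show "((\<lambda>s. integral {0..2 * pi} (\<lambda>x. norm (A s x))) has_real_derivative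
        integral {0..2 * pi} length_rate) (at \<tau>)"
      using length_deriv unfolding A_W A'_W_rate length_rate_def[abs_def] .
    show "integral {0..2 * pi} (\<lambda>x. norm (A s x)) =
        integral {0..2 * pi} (\<lambda>x. norm (tangent (\<gamma> s) x) / norm (\<gamma> s x) * cos (psi (\<gamma> s) x))"
      if "dist s \<tau> < \<epsilon>" for s
    proof (rule integral_cong)
      fix x assume "x \<in> {0..2 * pi}"
      then have "s \<in> J \<and> \<gamma> s x \<noteq> 0"
        using that by (intro near) (auto simp: dist_real_def)
      then show "norm (A s x) = norm (tangent (\<gamma> s) x) / norm (\<gamma> s x) * cos (psi (\<gamma> s) x)"
        using integrand[of s x] by simp
    qed
  qed simp
  moreover have "((\<lambda>x. a (norm (\<gamma> \<tau> x)) * norm (tangent (\<gamma> \<tau>) x) * sin (psi (\<gamma> \<tau>) x))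
        has_integral 0) {0..2 * pi}" if a: "continuous_on {0..} a" for a :: "real \<Rightarrow> real"
  proof -
    have "norm (\<gamma>x \<tau> x) * sin (psi (\<gamma> \<tau>) x) = (\<gamma> \<tau> x \<bullet> \<gamma>x \<tau> x) / norm (\<gamma> \<tau> x)" for x
      using \<gamma>x_nonzero[OF \<open>\<tau> \<in> J\<close>, of x] by (simp add: sin_psi tangent_eq)
    then have eq: "a (norm (\<gamma> \<tau> x)) * norm (tangent (\<gamma> \<tau>) x) * sin (psi (\<gamma> \<tau>) x) =
        a (norm (\<gamma> \<tau> x)) * ((\<gamma> \<tau> x \<bullet> \<gamma>x \<tau> x) / norm (\<gamma> \<tau> x))" for x
      by (simp add: tangent_eq mult.assoc)
    show ?thesis
      unfolding eq
    proof (rule radial_integral_zero)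
      show "\<gamma> \<tau> (2 * pi) = \<gamma> \<tau> 0"
        using periodic[of 0] by simp
    qed (use p_deriv p_nonzero a in simp_all)
  qed
  ultimately show ?thesis
    using balance by (simp add: density radial_points_eq kink_eq)
qed

end
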